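(* Let $R$ be an integral domain and let $(K,w)$ be a weighted simplicial complex with $K$ finite and $w:K\to R$, equipped with a discrete Morse function $f:K\to\mathbb{R}$. Let $a<b$ be real numbers. Suppose $\alpha^{(n)}\in K$ is a critical simplex with $f(\alpha)\in(a,b]$ and $f^{-1}((a,b])$ contains no other critical simplices. Let $$a'=\min\{x\in[a,f(\alpha))\mid f^{-1}((x,f(\alpha)])=\{\alpha\}\}.$$ Then $K(a')=K(f(\alpha))\setminus\{\alpha\}$, where $\alpha$ is a maximal face of $K(f(\alpha))$. Moreover, if all simplices in $f^{-1}((a,a'])\cup f^{-1}((f(\alpha),b])$ are $w$-simple, then $K(b)\searrow K(f(\alpha))$ and $K(a')\searrow K(a)$ are collapses that preserve weighted homology, i.e. $H_i(K(b),w)\cong H_i(K(f(\alpha)),w)$ and $H_i(K(a'),w)\cong H_i(K(a),w)$ for all $i\ge0$.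
   Context: $R$ is an integral domain (commutative, with unity). Simplicial complexes are finite abstract simplicial complexes (simplices are nonempty finite sets of vertices); $\sigma^{(n)}$ indicates that $\dim\sigma=n$, and $\sigma<\tau$ means $\sigma\subsetneq\tau$. A weighted simplicial complex (WSC) is a pair $(K,w)$ of a simplicial complex $K$ and a function $w:K\to R$ such that $\sigma_1\subseteq\sigma_2$ implies $w(\sigma_1)\mid w(\sigma_2)$ in $R$. $C_n(K,w)$ is the free $R$-module with basis the $n$-simplices of $K$ with nonzero weight ($C_{-1}=0$). Fixing a total order on the vertices, the weighted boundary map $\partial_n^w:C_n(K,w)\to C_{n-1}(K,w)$ is the $R$-linear map with $\partial_n^w(\sigma)=\sum_{i=0}^n\frac{w(\sigma)}{w(d_i\sigma)}(-1)^i d_i\sigma$, where $d_i[v_0,\dots,v_n]=[v_0,\dots,\widehat{v_i},\dots,v_n]$. The weighted homology is the $R$-module $H_n(K,w)=\ker(\partial_n^w)/\operatorname{Im}(\partial_{n+1}^w)$. For a subcomplex $L\subseteq K$, $(L,w)$ means $(L,w|_L)$. If $\sigma<\tau$ and $\sigma$ is not a proper face of any simplex of $K$ other than $\tau$, then $\sigma$ is a free face of $\tau$ (in $K$), and $K$ is said to collapse onto $K\setminus\{\sigma,\tau\}$ by an elementary collapse. $K\searrow L$ ($K$ collapses onto $L$) means that $K$ can be transformed into $L$ by a finite (possibly empty) sequence of elementary collapses. A function $f:K\to\mathbb{R}$ is a discrete Morse function if for every $\alpha^{(n)}\in K$: (1) $|\{\beta^{(n+1)}>\alpha\mid f(\beta)\le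 f(\alpha)\}|\le 1$ and (2) $|\{\gamma^{(n-1)}<\alpha\mid f(\gamma)\ge f(\alpha)\}|\le 1$. A simplex $\alpha^{(n)}$ is critical if both of these sets are empty. A simplex $\alpha^{(n)}$ is $w$-simple if $w(\alpha)\ne0$ and for all $\gamma^{(n-1)}<\alpha$, $f(\gamma)\ge f(\alpha)$ implies $w(\gamma)=w(\alpha)$. For $c\in\mathbb{R}$, the level subcomplex $K(c)$ is the subcomplex of $K$ consisting of all simplices $\alpha\in K$ with $f(\alpha)\le c$ together with all of their faces. *)

theory Defs
  imports Complex_Main "HOL-Library.Function_Algebras" "HOL-Library.Set_Algebras"
begin

section \<open>Weighted simplicial complexes\<close>

definition finite_simplicial_complex :: "'a set set \<Rightarrow> bool" where
  "finite_simplicial_complex K \<longleftrightarrow>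
     finite K \<and> (\<forall>\<sigma>\<in>K. finite \<sigma> \<and> \<sigma> \<noteq> {}) \<and>
     (\<forall>\<sigma>\<in>K. \<forall>\<tau>. \<tau> \<subseteq> \<sigma> \<and> \<tau> \<noteq> {} \<longrightarrow> \<tau> \<in> K)"

text \<open>Meaningful for nonempty finite \<open>\<sigma>\<close> only; note that the empty set is never a simplex.\<close>

definition sdim :: "'a set \<Rightarrow> nat" where
  "sdim \<sigma> = card \<sigma> - 1"

text \<open>A weight is given as a total function; only its values on \<open>K\<close> are ever used, so the
  restriction of the weight to a subcomplex \<open>L\<close> is again written \<open>w\<close>.\<close>

definition weighted_simplicial_complex :: "'a set set \<Rightarrow> ('a set \<Rightarrow> 'r::idom) \<Rightarrow> bool" where
  "weighted_simplicial_complex K w \<longleftrightarrow>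
     finite_simplicial_complex K \<and>
     (\<forall>\<sigma>\<^sub>1\<in>K. \<forall>\<sigma>\<^sub>2\<in>K. \<sigma>\<^sub>1 \<subseteq> \<sigma>\<^sub>2 \<longrightarrow> w \<sigma>\<^sub>1 dvd w \<sigma>\<^sub>2)"


section \<open>Weighted homology\<close>

definition chain_basis :: "'a set set \<Rightarrow> ('a set \<Rightarrow> 'r::idom) \<Rightarrow> nat \<Rightarrow> 'a set set" where
  "chain_basis K w n = {\<sigma>\<in>K. sdim \<sigma> = n \<and> w \<sigma> \<noteq> 0}"

text \<open>As the complexes are finite, the free module on a set of simplices consists of all
  coefficient functions that vanish off that set. Addition of chains is the pointwise one.\<close>

type_synonym ('a, 'r) chain = "'a set \<Rightarrow> 'r"

definition chains :: "'a set set \<Rightarrow> ('a set \<Rightarrow> 'r::idom) \<Rightarrow> nat \<Rightarrow> ('a, 'r) chain set" where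
  "chains K w n = {c. \<forall>\<sigma>. \<sigma> \<notin> chain_basis K w n \<longrightarrow> c \<sigma> = 0}"

definition chain_scale :: "'r::idom \<Rightarrow> ('a, 'r) chain \<Rightarrow> ('a, 'r) chain" where
  "chain_scale r c = (\<lambda>\<sigma>. r * c \<sigma>)"

definition basis_chain :: "'a set \<Rightarrow> ('a, 'r::idom) chain" where
  "basis_chain \<sigma> = (\<lambda>\<tau>. if \<tau> = \<sigma> then 1 else 0)"

text \<open>The total order on the vertices is that of the vertex type.\<close>

definition face_map :: "nat \<Rightarrow> 'a::linorder set \<Rightarrow> 'a set" where
  "face_map i \<sigma> = \<sigma> - {sorted_list_of_set \<sigma> ! i}"

text \<open>The quotient \<open>x / y\<close> of ring elements with \<open>y dvd x\<close> and \<open>y \<noteq> 0\<close>; it is unique since the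
  ring is an integral domain.\<close>

definition exact_quotient :: "'r::idom \<Rightarrow> 'r \<Rightarrow> 'r" where
  "exact_quotient x y = (THE q. x = q * y)"

definition simplex_boundary ::
  "('a::linorder set \<Rightarrow> 'r::idom) \<Rightarrow> nat \<Rightarrow> 'a set \<Rightarrow> ('a, 'r) chain" where
  "simplex_boundary w n \<sigma> =
     (\<Sum>i=0..n. chain_scale (exact_quotient (w \<sigma>) (w (face_map i \<sigma>)) * (-1) ^ i)
                   (basis_chain (face_map i \<sigma>)))"

text \<open>The case \<open>n = 0\<close> reflects the convention that there are no nonzero chains in degree \<open>-1\<close>.\<close>

definition boundary ::
  "'a::linorder set set \<Rightarrow> ('a set \<Rightarrow> 'r::idom) \<Rightarrow> nat \<Rightarrow> ('a, 'r) chain \<Rightarrow> ('a, 'r) chain" where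
  "boundary K w n c =
     (if n = 0 then 0
      else (\<Sum>\<sigma>\<in>chain_basis K w n. chain_scale (c \<sigma>) (simplex_boundary w n \<sigma>)))"

definition cycles :: "'a::linorder set set \<Rightarrow> ('a set \<Rightarrow> 'r::idom) \<Rightarrow> nat \<Rightarrow> ('a, 'r) chain set" where
  "cycles K w n = {c \<in> chains K w n. boundary K w n c = 0}"

definition boundaries :: "'a::linorder set set \<Rightarrow> ('a set \<Rightarrow> 'r::idom) \<Rightarrow> nat \<Rightarrow> ('a, 'r) chain set" where
  "boundaries K w n = boundary K w (n + 1) ` chains K w (n + 1)"

record ('r, 'm) module_structure =
  mcarrier :: "'m set"
  madd :: "'m \<Rightarrow> 'm \<Rightarrow> 'm"
  mscale :: "'r \<Rightarrow> 'm \<Rightarrow> 'm"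

text \<open>For a submodule \<open>B\<close> of \<open>Z\<close>, the elements of \<open>Z / B\<close> are the cosets \<open>z + B\<close>. In terms of
  the elementwise sum of sets, \<open>(y + B) + (z + B)\<close> is the coset of \<open>y + z\<close>. The elementwise
  multiple \<open>r (z + B)\<close> is only a subset of the coset of \<open>r z\<close>, hence the additional summand \<open>B\<close>.\<close>

definition quotient_module ::
  "('a, 'r::idom) chain set \<Rightarrow> ('a, 'r) chain set \<Rightarrow> ('r, ('a, 'r) chain set) module_structure" where
  "quotient_module Z B =
     \<lparr> mcarrier = (\<lambda>z. z +o B) ` Z,
       madd = (\<lambda>X Y. X + Y),
       mscale = (\<lambda>r X. chain_scale r ` X + B) \<rparr>"

definition homology ::
  "'a::linorder set set \<Rightarrow> ('a set \<Rightarrow> 'r::idom) \<Rightarrow> nat \<Rightarrow> ('r, ('a, 'r) chain set) module_structure" where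
  "homology K w n = quotient_module (cycles K w n) (boundaries K w n)"

definition module_isomorphic ::
  "('r, 'm) module_structure \<Rightarrow> ('r, 'n) module_structure \<Rightarrow> bool" where
  "module_isomorphic M N \<longleftrightarrow>
     (\<exists>\<phi>. bij_betw \<phi> (mcarrier M) (mcarrier N) \<and>
          (\<forall>x\<in>mcarrier M. \<forall>y\<in>mcarrier M. \<phi> (madd M x y) = madd N (\<phi> x) (\<phi> y)) \<and>
          (\<forall>r. \<forall>x\<in>mcarrier M. \<phi> (mscale M r x) = mscale N r (\<phi> x)))"


section \<open>Collapses\<close>

definition free_face :: "'a set set \<Rightarrow> 'a set \<Rightarrow> 'a set \<Rightarrow> bool" where
  "free_face K \<sigma> \<tau> \<longleftrightarrow> \<sigma> \<in> K \<and> \<tau> \<in> K \<and> \<sigma> \<subset> \<tau> \<and> (\<forall>\<rho>\<in>K. \<sigma> \<subset> \<rho> \<longrightarrow> \<rho> = \<tau>)"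

definition elementary_collapse :: "'a set set \<Rightarrow> 'a set set \<Rightarrow> bool" where
  "elementary_collapse K L \<longleftrightarrow> (\<exists>\<sigma> \<tau>. free_face K \<sigma> \<tau> \<and> L = K - {\<sigma>, \<tau>})"

definition collapses_onto :: "'a set set \<Rightarrow> 'a set set \<Rightarrow> bool" where
  "collapses_onto K L \<longleftrightarrow> rtranclp elementary_collapse K L"


section \<open>Discrete Morse functions\<close>

definition upper_exceptions :: "'a set set \<Rightarrow> ('a set \<Rightarrow> real) \<Rightarrow> 'a set \<Rightarrow> 'a set set" where
  "upper_exceptions K f \<alpha> = {\<beta>\<in>K. \<alpha> \<subset> \<beta> \<and> sdim \<beta> = sdim \<alpha> + 1 \<and> f \<beta> \<le> f \<alpha>}"

definition lower_exceptions :: "'a set set \<Rightarrow> ('a set \<Rightarrow> real) \<Rightarrow> 'a set \<Rightarrow> 'a set set" where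
  "lower_exceptions K f \<alpha> = {\<gamma>\<in>K. \<gamma> \<subset> \<alpha> \<and> sdim \<alpha> = sdim \<gamma> + 1 \<and> f \<gamma> \<ge> f \<alpha>}"

definition discrete_morse_function :: "'a set set \<Rightarrow> ('a set \<Rightarrow> real) \<Rightarrow> bool" where
  "discrete_morse_function K f \<longleftrightarrow>
     (\<forall>\<alpha>\<in>K. card (upper_exceptions K f \<alpha>) \<le> 1 \<and> card (lower_exceptions K f \<alpha>) \<le> 1)"

definition critical :: "'a set set \<Rightarrow> ('a set \<Rightarrow> real) \<Rightarrow> 'a set \<Rightarrow> bool" where
  "critical K f \<alpha> \<longleftrightarrow> \<alpha> \<in> K \<and> upper_exceptions K f \<alpha> = {} \<and> lower_exceptions K f \<alpha> = {}"

definition w_simple ::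
  "'a set set \<Rightarrow> ('a set \<Rightarrow> 'r::idom) \<Rightarrow> ('a set \<Rightarrow> real) \<Rightarrow> 'a set \<Rightarrow> bool" where
  "w_simple K w f \<alpha> \<longleftrightarrow> \<alpha> \<in> K \<and> w \<alpha> \<noteq> 0 \<and>
     (\<forall>\<gamma>\<in>K. \<gamma> \<subset> \<alpha> \<and> sdim \<alpha> = sdim \<gamma> + 1 \<and> f \<gamma> \<ge> f \<alpha> \<longrightarrow> w \<gamma> = w \<alpha>)"

definition level_subcomplex :: "'a set set \<Rightarrow> ('a set \<Rightarrow> real) \<Rightarrow> real \<Rightarrow> 'a set set" where
  "level_subcomplex K f c = {\<sigma>\<in>K. \<exists>\<alpha>\<in>K. f \<alpha> \<le> c \<and> \<sigma> \<subseteq> \<alpha>}"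

text \<open>The preimage of \<open>S\<close> under the function \<open>f\<close> restricted to \<open>K\<close>.\<close>

definition preimage :: "'a set set \<Rightarrow> ('a set \<Rightarrow> real) \<Rightarrow> real set \<Rightarrow> 'a set set" where
  "preimage K f S = {\<sigma>\<in>K. f \<sigma> \<in> S}"

end

(* A simplex that is not critical is paired with exactly one facet or cofacet whose value is in the
   wrong order, and a level subcomplex contains both members of a pair or neither. Hence K(d) - K(c)
   is a disjoint union of pairs when (c,d] contains no critical value. The lower simplex of the pair
   with the greatest upper value is a free face, so the pairs can be collapsed one after another.
   When both simplices of a pair have the same nonzero weight, the smaller one has a unit coefficient
   in the weighted boundary of the larger one, so the pair does not contribute to homology: inclusion
   induces an isomorphism. *)

theory Submission
  imports Defs
begin

section \<open>Pairs of a discrete Morse function\<close>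

text \<open>The Morse conditions compare only simplices whose dimensions differ by one, whereas
  level subcomplexes, maximality and free faces involve cofaces of every dimension. The bridge is a
  count: if \<gamma> \<subset> \<delta> has codimension at least two, then at least two simplices of
  dimension one above \<gamma>, and at least two of dimension one below \<delta>, lie between them.
  As a simplex has at most one exceptional facet and at most one exceptional cofacet, an
  unexceptional one can always be chosen. This one choice yields the disjointness of the pairs, the
  behaviour of levels on pairs and the free face. The weights need care for another reason. The
  lower simplex of a pair in K(d) - K(c) may have a value above d, where nothing is assumed about
  it. The upper simplex does have its value in (c,d], and w-simplicity of the upper simplex is
  exactly what equates the two weights.\<close>

locale discrete_morse =
  fixes K :: "'a set set" and f :: "'a set \<Rightarrow> real"
  assumes complex: "finite_simplicial_complex K"
    and morse: "discrete_morse_function K f"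
begin

definition paired :: "'a set \<Rightarrow> 'a set \<Rightarrow> bool" where
  "paired \<gamma> \<beta> \<longleftrightarrow>
     \<gamma> \<in> K \<and> \<beta> \<in> K \<and> \<gamma> \<subset> \<beta> \<and> sdim \<beta> = sdim \<gamma> + 1 \<and> f \<beta> \<le> f \<gamma>"

lemma finite_complex: "finite K"
  using complex by (simp add: finite_simplicial_complex_def)

lemma finite_simplex: "\<sigma> \<in> K \<Longrightarrow> finite \<sigma>"
  using complex by (simp add: finite_simplicial_complex_def)

lemma nonempty_simplex: "\<sigma> \<in> K \<Longrightarrow> \<sigma> \<noteq> {}"
  using complex by (simp add: finite_simplicial_complex_def)

lemma face_closed: "\<sigma> \<in> K \<Longrightarrow> \<tau> \<subseteq> \<sigma> \<Longrightarrow> \<tau> \<noteq> {} \<Longrightarrow> \<tau> \<in> K"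
  using complex unfolding finite_simplicial_complex_def by blast

lemma card_simplex: "\<sigma> \<in> K \<Longrightarrow> card \<sigma> = sdim \<sigma> + 1"
  using finite_simplex nonempty_simplex by (simp add: sdim_def card_gt_0_iff Suc_le_eq)

lemma critical_iff:
  "critical K f \<alpha> \<longleftrightarrow> \<alpha> \<in> K \<and> (\<forall>\<sigma>. \<not> paired \<alpha> \<sigma> \<and> \<not> paired \<sigma> \<alpha>)"
  by (auto simp: critical_def upper_exceptions_def lower_exceptions_def paired_def)

lemma upper_partner_unique:
  assumes "paired \<gamma> \<beta>" "paired \<gamma> \<beta>'" shows "\<beta> = \<beta>'"
proof -
  have "finite (upper_exceptions K f \<gamma>)"
    using finite_complex by (simp add: upper_exceptions_def)
  moreover have "card (upper_exceptions K f \<gamma>) \<le> Suc 0"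
    using morse assms by (auto simp: discrete_morse_function_def paired_def)
  moreover have "\<beta> \<in> upper_exceptions K f \<gamma>" "\<beta>' \<in> upper_exceptions K f \<gamma>"
    using assms by (auto simp: upper_exceptions_def paired_def)
  ultimately show ?thesis by (auto simp: card_le_Suc0_iff_eq)
qed

lemma lower_partner_unique:
  assumes "paired \<gamma> \<beta>" "paired \<gamma>' \<beta>" shows "\<gamma> = \<gamma>'"
proof -
  have "finite (lower_exceptions K f \<beta>)"
    using finite_complex by (simp add: lower_exceptions_def)
  moreover have "card (lower_exceptions K f \<beta>) \<le> Suc 0"
    using morse assms by (auto simp: discrete_morse_function_def paired_def)
  moreover have "\<gamma> \<in> lower_exceptions K f \<beta>" "\<gamma>' \<in> lower_exceptions K f \<beta>"
    using assms by (auto simp: lower_exceptions_def paired_def)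
  ultimately show ?thesis by (auto simp: card_le_Suc0_iff_eq)
qed

text \<open>Each of the two vertices can be added to \<gamma> or deleted from \<delta>, which gives
  two distinct candidates for a simplex in between.\<close>

lemma two_vertices_apart:
  assumes "\<gamma> \<in> K" "\<delta> \<in> K" "\<gamma> \<subset> \<delta>" "sdim \<delta> \<noteq> sdim \<gamma> + 1"
  obtains u v where "u \<noteq> v" "u \<in> \<delta> - \<gamma>" "v \<in> \<delta> - \<gamma>"
proof -
  have "card \<gamma> < card \<delta>" using assms finite_simplex psubset_card_mono by blast
  then have "1 < card (\<delta> - \<gamma>)"
    using assms card_simplex[of \<gamma>] card_simplex[of \<delta>] finite_simplex[of \<gamma>]
    by (subst card_Diff_subset) auto
  then obtain u where u: "u \<in> \<delta> - \<gamma>"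
    by (metis card.empty ex_in_conv not_one_less_zero)
  moreover have "0 < card (\<delta> - \<gamma> - {u})"
    using \<open>1 < card (\<delta> - \<gamma>)\<close> u assms finite_simplex[of \<delta>] by simp
  then obtain v where "v \<in> \<delta> - \<gamma> - {u}"
    by (metis card_gt_0_iff ex_in_conv)
  ultimately show thesis using that by blast
qed

text \<open>Here \<beta> is a simplex to be avoided. Adding \<open>u\<close> and adding
  \<open>v\<close> give different cofacets, so one of them is not \<beta>; the vertex that is left
  over keeps it strictly inside \<delta>.\<close>

lemma other_cofacet:
  assumes "\<gamma> \<in> K" "\<delta> \<in> K" "\<gamma> \<subset> \<delta>" "sdim \<delta> \<noteq> sdim \<gamma> + 1"
  obtains \<eta> where "\<eta> \<in> K" "\<gamma> \<subset> \<eta>" "\<eta> \<subset> \<delta>" "sdim \<eta> = sdim \<gamma> + 1" "\<eta> \<noteq> \<beta>"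
proof -
  obtain u v where uv: "u \<noteq> v" "u \<in> \<delta> - \<gamma>" "v \<in> \<delta> - \<gamma>"
    using two_vertices_apart assms by blast
  have "\<exists>x\<in>{u,v}. insert x \<gamma> \<noteq> \<beta>" using uv by auto
  then obtain x y where x: "x \<in> \<delta> - \<gamma>" "y \<in> \<delta> - \<gamma>" "x \<noteq> y" "insert x \<gamma> \<noteq> \<beta>" using uv by auto
  have K: "insert x \<gamma> \<in> K" using x assms by (auto intro: face_closed[OF \<open>\<delta> \<in> K\<close>])
  then have "sdim (insert x \<gamma>) = sdim \<gamma> + 1"
    using x assms card_simplex[of \<gamma>] card_simplex[of "insert x \<gamma>"] finite_simplex[of \<gamma>] by simp
  then show thesis using that[of "insert x \<gamma>"] K x assms by blast
qed

lemma other_facet: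
  assumes "\<gamma> \<in> K" "\<delta> \<in> K" "\<gamma> \<subset> \<delta>" "sdim \<delta> \<noteq> sdim \<gamma> + 1"
  obtains \<eta> where "\<eta> \<in> K" "\<gamma> \<subset> \<eta>" "\<eta> \<subset> \<delta>" "sdim \<delta> = sdim \<eta> + 1" "\<eta> \<noteq> \<beta>"
proof -
  obtain u v where uv: "u \<noteq> v" "u \<in> \<delta> - \<gamma>" "v \<in> \<delta> - \<gamma>"
    using two_vertices_apart assms by blast
  have "\<exists>x\<in>{u,v}. \<delta> - {x} \<noteq> \<beta>" using uv by auto
  then obtain x y where x: "x \<in> \<delta> - \<gamma>" "y \<in> \<delta> - \<gamma>" "x \<noteq> y" "\<delta> - {x} \<noteq> \<beta>" using uv by auto
  have K: "\<delta> - {x} \<in> K" using x assms by (auto intro: face_closed[OF \<open>\<delta> \<in> K\<close>])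
  then have "sdim \<delta> = sdim (\<delta> - {x}) + 1"
    using x assms card_simplex[of \<delta>] card_simplex[of "\<delta> - {x}"] finite_simplex[of \<delta>] by simp
  then show thesis using that[of "\<delta> - {x}"] K x assms by blast
qed

text \<open>At most one facet of \<open>\<delta>\<close> has value at least \<open>f \<delta>\<close>, and in codimension at least two there
  are two facets above \<open>\<gamma>\<close> to choose from.\<close>

lemma cofacet_le:
  assumes "\<gamma> \<in> K" "\<delta> \<in> K" "\<gamma> \<subset> \<delta>"
  shows "\<exists>\<beta>\<in>K. \<gamma> \<subset> \<beta> \<and> \<beta> \<subseteq> \<delta> \<and> sdim \<beta> = sdim \<gamma> + 1 \<and> f \<beta> \<le> f \<delta>"
  using assms(2,3)
proof (induction "sdim \<delta>" arbitrary: \<delta> rule: less_induct)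
  case less
  show ?case
  proof (cases "sdim \<delta> = sdim \<gamma> + 1")
    case True
    then show ?thesis using less.prems by blast
  next
    case False
    \<comment> \<open>If \<delta> has no lower partner, this holds for an arbitrary \<beta>.\<close>
    obtain \<beta> where \<beta>: "\<forall>\<sigma>. paired \<sigma> \<delta> \<longrightarrow> \<sigma> = \<beta>"
      using lower_partner_unique by metis
    obtain \<eta> where \<eta>: "\<eta> \<in> K" "\<gamma> \<subset> \<eta>" "\<eta> \<subset> \<delta>" "sdim \<delta> = sdim \<eta> + 1" "\<eta> \<noteq> \<beta>"
      using other_facet[OF assms(1) less.prems False] by blast
    then have "\<not> paired \<eta> \<delta>" using \<beta> by blast
    then have "f \<eta> \<le> f \<delta>" using \<eta> less.prems by (auto simp: paired_def)
    then show ?thesis using less.hyps[of \<eta>] \<eta> by fastforce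
  qed
qed

text \<open>Otherwise f \<epsilon> \<le> f \<beta> \<le> f \<gamma>. The other simplex \<eta>
  between \<gamma> and \<epsilon> is not the lower partner of \<epsilon>, so f \<eta> < f \<epsilon>
  \<le> f \<gamma>, and \<gamma> would have two upper partners.\<close>

lemma not_upper_and_lower:
  assumes "paired \<gamma> \<beta>" "paired \<beta> \<epsilon>" shows False
proof -
  have "\<gamma> \<in> K" "\<epsilon> \<in> K" "\<gamma> \<subset> \<epsilon>" "sdim \<epsilon> = sdim \<gamma> + 2"
    using assms by (auto simp: paired_def)
  then obtain \<eta> where \<eta>: "\<eta> \<in> K" "\<gamma> \<subset> \<eta>" "\<eta> \<subset> \<epsilon>" "sdim \<epsilon> = sdim \<eta> + 1" "\<eta> \<noteq> \<beta>"
    using other_facet[of \<gamma> \<epsilon>] by auto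
  then have "\<not> paired \<eta> \<epsilon>" using assms lower_partner_unique by blast
  then have "paired \<gamma> \<eta>" using \<eta> assms by (auto simp: paired_def)
  then show False using upper_partner_unique assms \<eta> by blast
qed

text \<open>By \<open>cofacet_le\<close> some cofacet of \<alpha> has value at most f \<delta>, and
  every cofacet of a critical simplex lies strictly above it in value.\<close>

lemma critical_coface_gt:
  assumes "critical K f \<alpha>" "\<delta> \<in> K" "\<alpha> \<subset> \<delta>" shows "f \<alpha> < f \<delta>"
proof -
  have "\<alpha> \<in> K" using assms by (simp add: critical_iff)
  then obtain \<beta> where "\<beta> \<in> K" "\<alpha> \<subset> \<beta>" "sdim \<beta> = sdim \<alpha> + 1" "f \<beta> \<le> f \<delta>"
    using cofacet_le assms by blast
  moreover have "\<not> paired \<alpha> \<beta>" using assms(1) by (simp add: critical_iff)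
  ultimately show ?thesis using \<open>\<alpha> \<in> K\<close> by (simp add: paired_def)
qed

text \<open>Ensures that the proper faces of \<alpha> stay in the level just below f \<alpha>. Any
  facet of \<alpha> that contains \<gamma> serves as \<eta>, since a critical simplex has no
  exceptional facet.\<close>

lemma critical_face_lt:
  assumes "critical K f \<alpha>" "\<gamma> \<in> K" "\<gamma> \<subset> \<alpha>"
  shows "\<exists>\<eta>\<in>K. \<gamma> \<subseteq> \<eta> \<and> \<eta> \<subset> \<alpha> \<and> f \<eta> < f \<alpha>"
proof -
  have "\<alpha> \<in> K" using assms by (simp add: critical_iff)
  obtain \<eta> where \<eta>: "\<eta> \<in> K" "\<gamma> \<subseteq> \<eta>" "\<eta> \<subset> \<alpha>" "sdim \<alpha> = sdim \<eta> + 1"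
  proof (cases "sdim \<alpha> = sdim \<gamma> + 1")
    case True
    then show thesis using that assms by blast
  next
    case False
    then show thesis using other_facet[OF assms(2) \<open>\<alpha> \<in> K\<close> assms(3)] that by blast
  qed
  moreover have "\<not> paired \<eta> \<alpha>" using assms(1) by (simp add: critical_iff)
  ultimately have "f \<eta> < f \<alpha>" using \<open>\<alpha> \<in> K\<close> by (simp add: paired_def)
  then show ?thesis using \<eta> by blast
qed

section \<open>Level subcomplexes\<close>

abbreviation level :: "real \<Rightarrow> 'a set set" where
  "level \<equiv> level_subcomplex K f"

lemma level_mono: "c \<le> d \<Longrightarrow> level c \<subseteq> level d"
  unfolding level_subcomplex_def by (blast intro: order_trans)

lemma level_of_le: "\<sigma> \<in> K \<Longrightarrow> f \<sigma> \<le> c \<Longrightarrow> \<sigma> \<in> level c"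
  by (auto simp: level_subcomplex_def)

lemma levelE:
  assumes "\<sigma> \<in> level c"
  obtains \<delta> where "\<sigma> \<in> K" "\<delta> \<in> K" "f \<delta> \<le> c" "\<sigma> \<subseteq> \<delta>"
  using assms by (auto simp: level_subcomplex_def)

lemma level_subset: "level c \<subseteq> K"
  by (auto simp: level_subcomplex_def)

lemma level_face: "\<sigma> \<in> level c \<Longrightarrow> \<tau> \<subseteq> \<sigma> \<Longrightarrow> \<tau> \<in> K \<Longrightarrow> \<tau> \<in> level c"
  by (auto simp: level_subcomplex_def)

text \<open>A simplex containing \<alpha> has value at least f \<alpha> > c, so \<alpha> itself
  drops out. A proper face of \<alpha> lies in some \<eta> of smaller value, and the preimage
  condition pushes that value down to at most c.\<close>

lemma level_critical:
  assumes "critical K f \<alpha>" "c < f \<alpha>" "preimage K f {c<..f \<alpha>} = {\<alpha>}"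
  shows "level c = level (f \<alpha>) - {\<alpha>}"
proof (intro equalityI subsetI)
  fix \<sigma> assume \<sigma>: "\<sigma> \<in> level c"
  then obtain \<delta> where \<delta>: "\<delta> \<in> K" "f \<delta> \<le> c" "\<sigma> \<subseteq> \<delta>" by (rule levelE)
  have "\<not> \<alpha> \<subseteq> \<delta>"
    using critical_coface_gt[OF assms(1) \<delta>(1)] assms(2) \<delta>(2) by (cases "\<alpha> = \<delta>") auto
  then show "\<sigma> \<in> level (f \<alpha>) - {\<alpha>}" using \<sigma> \<delta>(3) level_mono[of c "f \<alpha>"] assms(2) by auto
next
  fix \<sigma> assume \<sigma>: "\<sigma> \<in> level (f \<alpha>) - {\<alpha>}"
  have below: "\<tau> \<in> level c" if "\<tau> \<in> K" "f \<tau> \<le> f \<alpha>" "\<tau> \<noteq> \<alpha>" for \<tau>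
  proof -
    have "\<tau> \<notin> preimage K f {c<..f \<alpha>}" using assms(3) that by blast
    then have "f \<tau> \<le> c" using that by (auto simp: preimage_def)
    then show ?thesis using that level_of_le by blast
  qed
  have "\<sigma> \<in> level (f \<alpha>)" using \<sigma> by blast
  then obtain \<tau> where \<tau>: "\<sigma> \<in> K" "\<tau> \<in> K" "f \<tau> \<le> f \<alpha>" "\<sigma> \<subseteq> \<tau>" by (rule levelE)
  show "\<sigma> \<in> level c"
  proof (cases "\<tau> = \<alpha>")
    case True
    then obtain \<eta> where "\<eta> \<in> K" "\<sigma> \<subseteq> \<eta>" "\<eta> \<subset> \<alpha>" "f \<eta> < f \<alpha>"
      using critical_face_lt[OF assms(1), of \<sigma>] \<sigma> \<tau> by blast
    then show ?thesis using below[of \<eta>] level_face \<tau>(1) by auto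
  next
    case False
    then show ?thesis using below[of \<tau>] level_face \<tau> by blast
  qed
qed

text \<open>The nontrivial case is f \<beta> > c. Then \<gamma> is in the level only as a proper
  face of some \<delta> with f \<delta> \<le> c. A cofacet of \<gamma> inside \<delta> with value at
  most c is an upper partner of \<gamma>, hence is \<beta>, so \<beta> \<subseteq> \<delta>.\<close>

lemma level_paired:
  assumes "paired \<gamma> \<beta>" shows "\<gamma> \<in> level c \<longleftrightarrow> \<beta> \<in> level c"
proof
  assume "\<gamma> \<in> level c"
  then obtain \<delta> where \<delta>: "\<delta> \<in> K" "f \<delta> \<le> c" "\<gamma> \<subseteq> \<delta>" by (rule levelE)
  show "\<beta> \<in> level c"
  proof (cases "f \<beta> \<le> c")
    case True
    then show ?thesis using assms by (auto simp: level_subcomplex_def paired_def)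
  next
    case False
    then have "f \<gamma> > c" using assms by (auto simp: paired_def)
    then have "\<gamma> \<subset> \<delta>" using \<delta> by auto
    then obtain \<beta>' where \<beta>': "\<beta>' \<in> K" "\<gamma> \<subset> \<beta>'" "\<beta>' \<subseteq> \<delta>" "sdim \<beta>' = sdim \<gamma> + 1" "f \<beta>' \<le> f \<delta>"
      using cofacet_le assms \<delta> by (metis paired_def)
    then have "paired \<gamma> \<beta>'" using \<open>f \<gamma> > c\<close> \<delta> assms by (auto simp: paired_def)
    then show ?thesis using upper_partner_unique[OF assms] \<beta>' \<delta> by (auto simp: level_subcomplex_def)
  qed
next
  assume "\<beta> \<in> level c"
  then show "\<gamma> \<in> level c" using assms level_face by (auto simp: paired_def)
qed

text \<open>A simplex with value above d enters the level as a proper face of some \<delta> with f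
  \<delta> \<le> d; \<open>cofacet_le\<close> then supplies an upper partner. All others have value
  in (c,d] and are not critical by hypothesis.\<close>

lemma level_diff_paired:
  assumes "\<forall>\<sigma>\<in>preimage K f {c<..d}. \<not> critical K f \<sigma>" and \<sigma>: "\<sigma> \<in> level d - level c"
  obtains \<tau> where "paired \<sigma> \<tau> \<or> paired \<tau> \<sigma>"
proof (cases "f \<sigma> \<le> d")
  case True
  have "\<sigma> \<in> K" using \<sigma> level_subset by blast
  moreover have "f \<sigma> > c" using \<sigma> \<open>\<sigma> \<in> K\<close> level_of_le[of \<sigma> c] by (metis DiffD2 not_le)
  ultimately have "\<not> critical K f \<sigma>" using assms(1) True by (auto simp: preimage_def)
  then show thesis using \<open>\<sigma> \<in> K\<close> that by (auto simp: critical_iff)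
next
  case False
  have "\<sigma> \<in> level d" using \<sigma> by blast
  then obtain \<delta> where \<delta>: "\<sigma> \<in> K" "\<delta> \<in> K" "f \<delta> \<le> d" "\<sigma> \<subseteq> \<delta>" by (rule levelE)
  then have "\<sigma> \<subset> \<delta>" using False by auto
  then obtain \<beta> where "\<beta> \<in> K" "\<sigma> \<subset> \<beta>" "sdim \<beta> = sdim \<sigma> + 1" "f \<beta> \<le> f \<delta>"
    using cofacet_le[of \<sigma> \<delta>] \<delta> by blast
  then show thesis using that[of \<beta>] \<delta> False by (auto simp: paired_def)
qed

text \<open>The hypothesis is applied to \<beta>, because f \<gamma> may exceed d. If f \<beta>
  exceeded d as well, a cofacet of \<gamma> with value at most d would be a second upper
  partner.\<close>

lemma level_diff_w_simple:
  assumes "\<forall>\<sigma>\<in>preimage K f {c<..d}. w_simple K w f \<sigma>"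
    and "paired \<gamma> \<beta>" "\<gamma> \<in> level d - level c"
  shows "w \<gamma> = w \<beta>" "w \<beta> \<noteq> 0"
proof -
  have \<beta>: "\<beta> \<in> K" using assms(2) by (simp add: paired_def)
  have "f \<beta> > c" using assms(3) level_paired[OF assms(2), of c] level_of_le[OF \<beta>, of c]
    by (metis DiffD2 not_le)
  have "f \<beta> \<le> d"
  proof (rule ccontr)
    assume d: "\<not> f \<beta> \<le> d"
    have "\<gamma> \<in> level d" using assms(3) by blast
    then obtain \<delta> where \<delta>: "\<delta> \<in> K" "f \<delta> \<le> d" "\<gamma> \<subseteq> \<delta>" by (rule levelE)
    then have "\<gamma> \<subset> \<delta>" using d assms(2) by (auto simp: paired_def)
    then obtain \<beta>' where \<beta>': "\<beta>' \<in> K" "\<gamma> \<subset> \<beta>'" "sdim \<beta>' = sdim \<gamma> + 1" "f \<beta>' \<le> f \<delta>"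
      using cofacet_le assms(2) \<delta> by (metis paired_def)
    then have "paired \<gamma> \<beta>'" using d \<delta> assms(2) by (auto simp: paired_def)
    then show False using upper_partner_unique[OF assms(2)] \<beta>' d \<delta> by auto
  qed
  then have "w_simple K w f \<beta>" using assms(1) \<beta> \<open>f \<beta> > c\<close> by (auto simp: preimage_def)
  then show "w \<gamma> = w \<beta>" "w \<beta> \<noteq> 0" using assms(2) by (auto simp: w_simple_def paired_def)
qed

text \<open>Intermediate complexes of the collapse need not be level subcomplexes, since \<open>f\<close> need not be
  injective. The pair whose larger simplex has the greatest value can be removed first.\<close>

lemma exists_free_pair:
  assumes L: "L \<subseteq> K" "\<And>\<sigma> \<tau>. \<sigma> \<in> L \<Longrightarrow> \<tau> \<subseteq> \<sigma> \<Longrightarrow> \<tau> \<in> K \<Longrightarrow> \<tau> \<in> L"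
    and N: "\<And>\<sigma> \<tau>. \<sigma> \<in> N \<Longrightarrow> \<tau> \<subseteq> \<sigma> \<Longrightarrow> \<tau> \<in> K \<Longrightarrow> \<tau> \<in> N"
    and L_paired: "\<And>\<gamma> \<beta>. paired \<gamma> \<beta> \<Longrightarrow> \<gamma> \<in> L \<longleftrightarrow> \<beta> \<in> L"
    and N_paired: "\<And>\<gamma> \<beta>. paired \<gamma> \<beta> \<Longrightarrow> \<gamma> \<in> N \<longleftrightarrow> \<beta> \<in> N"
    and all_paired: "\<And>\<sigma>. \<sigma> \<in> L - N \<Longrightarrow> \<exists>\<tau>. paired \<sigma> \<tau> \<or> paired \<tau> \<sigma>"
    and "L - N \<noteq> {}"
  shows "\<exists>\<gamma> \<beta>. paired \<gamma> \<beta> \<and> free_face L \<gamma> \<beta> \<and> \<gamma> \<in> L - N \<and> \<beta> \<in> L - N"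
proof -
  define U where "U = {\<beta> \<in> L - N. \<exists>\<gamma>. paired \<gamma> \<beta>}"
  have "finite U" using finite_complex L(1) finite_subset by (fastforce simp: U_def)
  moreover have "U \<noteq> {}"
  proof -
    obtain \<sigma> \<tau> where \<sigma>: "\<sigma> \<in> L - N" "paired \<sigma> \<tau> \<or> paired \<tau> \<sigma>" using assms(7) all_paired by blast
    show ?thesis
    proof (cases "paired \<tau> \<sigma>")
      case True
      then show ?thesis using \<sigma>(1) unfolding U_def by blast
    next
      case False
      then have "paired \<sigma> \<tau>" using \<sigma>(2) by blast
      then have "\<tau> \<in> U" using L_paired[of \<sigma> \<tau>] N_paired[of \<sigma> \<tau>] \<sigma>(1) unfolding U_def by blast
      then show ?thesis by blast
    qed
  qed
  ultimately have "Max (f ` U) \<in> f ` U" by (intro Max_in) auto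
  then obtain \<beta> where \<beta>: "\<beta> \<in> U" "f \<beta> = Max (f ` U)" by auto
  then have max: "f \<beta>' \<le> f \<beta>" if "\<beta>' \<in> U" for \<beta>'
    using that \<open>finite U\<close> by simp
  obtain \<gamma> where \<gamma>: "paired \<gamma> \<beta>" "\<gamma> \<in> L - N" using \<beta>(1) L_paired N_paired unfolding U_def by blast
  then have \<gamma>K: "\<gamma> \<in> K" by (simp add: paired_def)
  have "\<delta> = \<beta>" if \<delta>: "\<delta> \<in> L" "\<gamma> \<subset> \<delta>" for \<delta>
  proof (rule ccontr)
    assume "\<delta> \<noteq> \<beta>"
    \<comment> \<open>A second coface of any dimension yields a second cofacet, to which the Morse
      conditions apply.\<close>
    have "\<exists>\<delta>'\<in>K. \<gamma> \<subset> \<delta>' \<and> \<delta>' \<subseteq> \<delta> \<and> sdim \<delta>' = sdim \<gamma> + 1 \<and> \<delta>' \<noteq> \<beta>"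
    proof (cases "sdim \<delta> = sdim \<gamma> + 1")
      case True
      then show ?thesis using \<delta> \<open>\<delta> \<noteq> \<beta>\<close> L(1) by blast
    next
      case False
      have "\<delta> \<in> K" using \<delta> L(1) by blast
      then obtain \<eta> where "\<eta> \<in> K" "\<gamma> \<subset> \<eta>" "\<eta> \<subset> \<delta>" "sdim \<eta> = sdim \<gamma> + 1" "\<eta> \<noteq> \<beta>"
        using other_cofacet[OF \<gamma>K _ \<delta>(2) False] by metis
      then show ?thesis by blast
    qed
    then obtain \<delta>' where \<delta>': "\<delta>' \<in> K" "\<gamma> \<subset> \<delta>'" "\<delta>' \<subseteq> \<delta>" "sdim \<delta>' = sdim \<gamma> + 1" "\<delta>' \<noteq> \<beta>"
      by blast
    have "\<delta>' \<in> L - N" using \<delta>' \<delta> L(2) N[of \<delta>' \<gamma>] \<gamma> \<gamma>K by blast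
    have "f \<gamma> < f \<delta>'"
      using upper_partner_unique[OF \<gamma>(1), of \<delta>'] \<delta>' \<gamma>K by (fastforce simp: paired_def)
    moreover have "f \<beta> \<le> f \<gamma>" using \<gamma> by (simp add: paired_def)
    \<comment> \<open>So f \<delta>' > f \<gamma> \<ge> f \<beta>, and by maximality \<delta>' can
      only be the lower simplex of its pair.\<close>
    ultimately have "\<delta>' \<notin> U" using max by fastforce
    then obtain \<epsilon> where \<epsilon>: "paired \<delta>' \<epsilon>"
      using all_paired \<open>\<delta>' \<in> L - N\<close> unfolding U_def by blast
    then have "\<epsilon> \<in> U" using \<open>\<delta>' \<in> L - N\<close> L_paired N_paired unfolding U_def by blast
    have codim: "\<epsilon> \<in> K" "\<gamma> \<subset> \<epsilon>" "sdim \<epsilon> = sdim \<gamma> + 2" using \<epsilon> \<delta>' by (auto simp: paired_def)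
    \<comment> \<open>The other simplex between \<gamma> and \<epsilon> satisfies f \<eta> < f
      \<epsilon> \<le> f \<beta> \<le> f \<gamma>. It is an upper partner of \<gamma>, and f \<eta>
      < f \<beta> shows that it is not \<beta>.\<close>
    then obtain \<eta> where \<eta>: "\<eta> \<in> K" "\<gamma> \<subset> \<eta>" "\<eta> \<subset> \<epsilon>" "sdim \<epsilon> = sdim \<eta> + 1" "\<eta> \<noteq> \<delta>'"
      using other_facet[of \<gamma> \<epsilon>] \<gamma>K by auto
    then have "f \<eta> < f \<epsilon>"
      using lower_partner_unique[OF \<epsilon>, of \<eta>] \<open>\<epsilon> \<in> K\<close> by (fastforce simp: paired_def)
    also have "\<dots> \<le> f \<beta>" using max \<open>\<epsilon> \<in> U\<close> .
    finally have "f \<eta> < f \<beta>" .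
    moreover have "paired \<gamma> \<eta>"
      using \<open>f \<eta> < f \<beta>\<close> \<open>f \<beta> \<le> f \<gamma>\<close> \<eta> \<gamma>K codim(3) by (auto simp: paired_def)
    ultimately show False using upper_partner_unique[OF \<gamma>(1)] by blast
  qed
  then have "free_face L \<gamma> \<beta>" using \<beta> \<gamma> by (auto simp: free_face_def U_def paired_def)
  then show ?thesis using \<beta>(1) \<gamma> unfolding U_def by blast
qed

text \<open>Pairs are disjoint or equal, so deleting one pair never splits another.\<close>

lemma paired_in_pair_iff:
  assumes "paired \<gamma> \<beta>" "paired \<gamma>' \<beta>'" shows "\<gamma>' \<in> {\<gamma>,\<beta>} \<longleftrightarrow> \<beta>' \<in> {\<gamma>,\<beta>}"
  using assms upper_partner_unique lower_partner_unique not_upper_and_lower by blast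

end

section \<open>The weighted chain complex\<close>

lemma sum_fun_apply: "(\<Sum>i\<in>A. g i) x = (\<Sum>i\<in>A. g i x)"
  by (induction A rule: infinite_finite_induct) auto

lemma exact_quotient_mult:
  fixes x y :: "'r::idom"
  assumes "y dvd x" "y \<noteq> 0" shows "exact_quotient x y * y = x"
proof -
  obtain q where "x = q * y" using assms(1) by (metis dvd_def mult.commute)
  then have "\<exists>!q. x = q * y" using assms(2) by auto
  then have "x = exact_quotient x y * y" unfolding exact_quotient_def by (rule theI')
  then show ?thesis by (rule sym)
qed

lemma exact_quotient_self: "(x::'r::idom) \<noteq> 0 \<Longrightarrow> exact_quotient x x = 1"
  using exact_quotient_mult[of x x] by simp

text \<open>Weights telescope: the weight factor of a codimension-two face in the double boundary
  does not depend on the facet in between.\<close>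

lemma exact_quotient_chain:
  fixes x y z :: "'r::idom"
  assumes "z dvd y" "y dvd x" "y \<noteq> 0" "z \<noteq> 0"
  shows "exact_quotient x y * exact_quotient y z = exact_quotient x z"
proof -
  have "z dvd x" using assms(1,2) by (rule dvd_trans)
  then have "exact_quotient x y * exact_quotient y z * z = exact_quotient x z * z"
    using assms by (simp add: mult.assoc exact_quotient_mult)
  then show ?thesis using assms(4) by simp
qed

text \<open>The exponent is the position of \<open>v\<close> in \<sigma>, so this is the sign in the
  boundary formula. Indexing by vertices avoids shifting indices when two vertices are deleted in
  turn.\<close>

definition face_sign :: "'a::linorder set \<Rightarrow> 'a \<Rightarrow> 'r::idom" where
  "face_sign \<sigma> v = (-1) ^ card {u\<in>\<sigma>. u < v}"

lemma face_sign_sq: "face_sign \<sigma> v * face_sign \<sigma> v = (1::'r::idom)"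
  by (simp add: face_sign_def flip: power_mult_distrib)

lemma card_less_nth:
  fixes \<sigma> :: "'a::linorder set"
  assumes "finite \<sigma>" "i < card \<sigma>"
  shows "card {u\<in>\<sigma>. u < sorted_list_of_set \<sigma> ! i} = i"
proof -
  let ?s = "sorted_list_of_set \<sigma>"
  have len: "length ?s = card \<sigma>" using assms by simp
  have iff: "?s ! j < ?s ! i \<longleftrightarrow> j < i" if "j < card \<sigma>" for j
  proof -
    have "sorted_wrt (<) ?s" by simp
    then have *: "\<And>p q. p < q \<Longrightarrow> q < card \<sigma> \<Longrightarrow> ?s ! p < ?s ! q"
      using len by (simp add: sorted_wrt_iff_nth_less)
    show ?thesis using *[of i j] *[of j i] assms that by (metis less_asym linorder_neqE_nat less_irrefl)
  qed
  have "{u\<in>\<sigma>. u < ?s ! i} = (\<lambda>j. ?s ! j) ` {..<i}"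
  proof (intro equalityI subsetI)
    fix u assume u: "u \<in> {u\<in>\<sigma>. u < ?s ! i}"
    then have "u \<in> set ?s" using assms by simp
    then obtain j where "j < card \<sigma>" "u = ?s ! j" using len by (auto simp: in_set_conv_nth)
    then show "u \<in> (\<lambda>j. ?s ! j) ` {..<i}" using u iff by auto
  next
    fix u assume "u \<in> (\<lambda>j. ?s ! j) ` {..<i}"
    then obtain j where j: "j < i" "u = ?s ! j" by auto
    then have "u \<in> set ?s" using assms len by (metis nth_mem order_less_trans)
    then show "u \<in> {u\<in>\<sigma>. u < ?s ! i}" using j iff[of j] assms by simp
  qed
  moreover have "inj_on (\<lambda>j. ?s ! j) {..<i}"
    using assms len by (auto simp: inj_on_def nth_eq_iff_index_eq)
  ultimately show ?thesis by (simp add: card_image)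
qed

text \<open>Replaces the sum over positions by a sum over vertices. Evaluation at one \<tau> turns
  identities between chains into identities in the ring.\<close>

lemma simplex_boundary_apply:
  fixes w :: "'a::linorder set \<Rightarrow> 'r::idom"
  assumes "finite \<sigma>" "card \<sigma> = n + 1"
  shows "simplex_boundary w n \<sigma> \<tau> =
    (\<Sum>v\<in>\<sigma>. if \<tau> = \<sigma> - {v} then exact_quotient (w \<sigma>) (w \<tau>) * face_sign \<sigma> v else 0)"
proof -
  let ?s = "sorted_list_of_set \<sigma>"
  have "bij_betw (\<lambda>i. ?s ! i) {..<card \<sigma>} \<sigma>"
    using assms by (intro bij_betw_nth) auto
  then have bij: "bij_betw (\<lambda>i. ?s ! i) {0..n} \<sigma>"
    using assms by (simp add: lessThan_Suc_atMost atLeast0AtMost)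
  have "simplex_boundary w n \<sigma> \<tau> = (\<Sum>i=0..n. if \<tau> = \<sigma> - {?s ! i}
      then exact_quotient (w \<sigma>) (w \<tau>) * face_sign \<sigma> (?s ! i) else 0)"
    unfolding simplex_boundary_def sum_fun_apply
    using assms card_less_nth[of \<sigma>]
    by (intro sum.cong) (auto simp: chain_scale_def basis_chain_def face_map_def face_sign_def)
  also have "\<dots> = (\<Sum>v\<in>\<sigma>. if \<tau> = \<sigma> - {v} then exact_quotient (w \<sigma>) (w \<tau>) * face_sign \<sigma> v else 0)"
    by (rule sum.reindex_bij_betw[OF bij])
  finally show ?thesis .
qed

lemma simplex_boundary_facet:
  fixes w :: "'a::linorder set \<Rightarrow> 'r::idom"
  assumes "finite \<sigma>" "card \<sigma> = n + 1" "v \<in> \<sigma>"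
  shows "simplex_boundary w n \<sigma> (\<sigma> - {v}) = exact_quotient (w \<sigma>) (w (\<sigma> - {v})) * face_sign \<sigma> v"
proof -
  have "simplex_boundary w n \<sigma> (\<sigma> - {v}) =
      (\<Sum>u\<in>\<sigma>. if u = v then exact_quotient (w \<sigma>) (w (\<sigma> - {v})) * face_sign \<sigma> u else 0)"
    unfolding simplex_boundary_apply[OF assms(1,2)] using assms(3) by (intro sum.cong) auto
  then show ?thesis using assms by simp
qed

lemma simplex_boundary_eq_0:
  fixes w :: "'a::linorder set \<Rightarrow> 'r::idom"
  assumes "finite \<sigma>" "card \<sigma> = n + 1" "\<And>v. v \<in> \<sigma> \<Longrightarrow> \<tau> \<noteq> \<sigma> - {v}"
  shows "simplex_boundary w n \<sigma> \<tau> = 0"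
  using assms by (simp add: simplex_boundary_apply)

text \<open>In characteristic two antisymmetry alone would not make the double sum vanish; the terms are
  cancelled in pairs.\<close>

lemma sum_antisymmetric:
  fixes g :: "'a::linorder \<Rightarrow> 'a \<Rightarrow> 'r::idom"
  assumes "finite S" "\<And>u v. u \<in> S \<Longrightarrow> v \<in> S \<Longrightarrow> u < v \<Longrightarrow> g u v = - g v u"
  shows "(\<Sum>v\<in>S. \<Sum>u\<in>S - {v}. g v u) = 0"
proof -
  let ?P = "{p \<in> S \<times> S. fst p < snd p}" and ?Q = "{p \<in> S \<times> S. snd p < fst p}"
  let ?g = "\<lambda>p. g (fst p) (snd p)"
  have "(\<Sum>v\<in>S. \<Sum>u\<in>S - {v}. g v u) = sum ?g (SIGMA v:S. S - {v})"
    using assms(1) by (simp add: sum.Sigma case_prod_beta)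
  also have "(SIGMA v:S. S - {v}) = ?P \<union> ?Q" by auto
  also have "sum ?g (?P \<union> ?Q) = sum ?g ?P + sum ?g ?Q"
    using assms(1) by (intro sum.union_disjoint) auto
  also have "sum ?g ?Q = (\<Sum>p\<in>?P. g (snd p) (fst p))"
    by (rule sum.reindex_bij_witness[of _ prod.swap prod.swap]) auto
  also have "\<dots> = (\<Sum>p\<in>?P. - ?g p)" using assms(2) by (intro sum.cong) auto
  finally show ?thesis by (simp add: sum_negf)
qed

text \<open>Deleting the smaller vertex \<open>u\<close> lowers the position of \<open>v\<close> by
  one, while deleting \<open>v\<close> leaves the position of \<open>u\<close> unchanged.\<close>

lemma face_sign_swap:
  fixes \<sigma> :: "'a::linorder set"
  assumes "finite \<sigma>" "u \<in> \<sigma>" "u < v"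
  shows "face_sign \<sigma> u * face_sign (\<sigma> - {u}) v = - (face_sign \<sigma> v * face_sign (\<sigma> - {v}) u :: 'r::idom)"
proof -
  have "{x\<in>\<sigma> - {v}. x < u} = {x\<in>\<sigma>. x < u}" using assms by auto
  moreover have "{x\<in>\<sigma>. x < v} = insert u {x\<in>\<sigma> - {u}. x < v}" using assms by auto
  then have "card {x\<in>\<sigma>. x < v} = Suc (card {x\<in>\<sigma> - {u}. x < v})"
    using assms by simp
  ultimately show ?thesis by (simp add: face_sign_def)
qed

lemma boundary_apply:
  assumes "n \<noteq> 0"
  shows "boundary K w n c \<tau> = (\<Sum>\<sigma>\<in>chain_basis K w n. c \<sigma> * simplex_boundary w n \<sigma> \<tau>)"
  using assms by (simp add: boundary_def sum_fun_apply chain_scale_def)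

lemma boundary_diff: "boundary K w n (c - d) = boundary K w n c - boundary K w n d"
  by (rule ext, cases "n = 0")
    (simp_all add: boundary_apply left_diff_distrib sum_subtractf, simp add: boundary_def)

lemma boundary_add: "boundary K w n (c + d) = boundary K w n c + boundary K w n d"
  by (rule ext, cases "n = 0")
    (simp_all add: boundary_apply distrib_right sum.distrib, simp add: boundary_def)

lemma boundary_scale: "boundary K w n (chain_scale r c) = chain_scale r (boundary K w n c)"
  by (rule ext, cases "n = 0")
    (simp_all add: boundary_apply chain_scale_def sum_distrib_left mult.assoc, simp add: boundary_def)

lemma boundary_basis_chain:
  assumes "finite K" "\<sigma> \<in> chain_basis K w n" "n \<noteq> 0"
  shows "boundary K w n (basis_chain \<sigma>) = simplex_boundary w n \<sigma>"
proof
  fix \<tau>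
  have "finite (chain_basis K w n)" using assms(1) by (simp add: chain_basis_def)
  then show "boundary K w n (basis_chain \<sigma>) \<tau> = simplex_boundary w n \<sigma> \<tau>"
    using assms(2,3)
    by (simp add: boundary_apply basis_chain_def if_distrib[of "\<lambda>x. x * _"] sum.delta cong: if_cong)
qed

text \<open>The additional simplices of K have coefficient zero. Hence inclusion is a chain map, and
  all boundaries can be computed in K.\<close>

lemma boundary_subcomplex:
  assumes "L \<subseteq> K" "finite K" "c \<in> chains L w n"
  shows "boundary L w n c = boundary K w n c"
proof (cases "n = 0")
  case False
  have "(\<Sum>\<sigma>\<in>chain_basis L w n. c \<sigma> * simplex_boundary w n \<sigma> \<tau>)
      = (\<Sum>\<sigma>\<in>chain_basis K w n. c \<sigma> * simplex_boundary w n \<sigma> \<tau>)" for \<tau>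
    using assms by (intro sum.mono_neutral_left) (auto simp: chain_basis_def chains_def)
  then show ?thesis using False by (auto simp: boundary_apply)
qed (simp add: boundary_def)

lemma chains_closed:
  "c \<in> chains K w n \<Longrightarrow> d \<in> chains K w n \<Longrightarrow> c - d \<in> chains K w n"
  "c \<in> chains K w n \<Longrightarrow> d \<in> chains K w n \<Longrightarrow> c + d \<in> chains K w n"
  "c \<in> chains K w n \<Longrightarrow> chain_scale r c \<in> chains K w n"
  "0 \<in> chains K w n"
  by (auto simp: chains_def chain_scale_def)

lemma chains_mono: "L \<subseteq> K \<Longrightarrow> chains L w n \<subseteq> chains K w n"
  by (auto simp: chains_def chain_basis_def)

section \<open>Facets in a weighted complex and the square of the boundary map\<close>

locale weighted_complex =
  fixes K :: "'a::linorder set set" and w :: "'a set \<Rightarrow> 'r::idom"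
  assumes wsc: "weighted_simplicial_complex K w"
begin

lemma finite_K: "finite K"
  using wsc by (simp add: weighted_simplicial_complex_def finite_simplicial_complex_def)

lemma finite_nonempty: "\<sigma> \<in> K \<Longrightarrow> finite \<sigma> \<and> \<sigma> \<noteq> {}"
  using wsc by (simp add: weighted_simplicial_complex_def finite_simplicial_complex_def)

lemma face_in_K: "\<sigma> \<in> K \<Longrightarrow> \<tau> \<subseteq> \<sigma> \<Longrightarrow> \<tau> \<noteq> {} \<Longrightarrow> \<tau> \<in> K"
  using wsc unfolding weighted_simplicial_complex_def finite_simplicial_complex_def by blast

lemma weight_dvd: "\<sigma> \<in> K \<Longrightarrow> \<tau> \<subseteq> \<sigma> \<Longrightarrow> \<tau> \<noteq> {} \<Longrightarrow> w \<tau> dvd w \<sigma>"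
  using wsc face_in_K[of \<sigma> \<tau>] unfolding weighted_simplicial_complex_def by blast

lemma chain_basis_iff:
  "\<sigma> \<in> chain_basis K w n \<longleftrightarrow> \<sigma> \<in> K \<and> finite \<sigma> \<and> card \<sigma> = n + 1 \<and> w \<sigma> \<noteq> 0"
proof -
  \<comment> \<open>The subtraction in \<open>sdim\<close> truncates, so for n = 0 the empty set
    must be excluded.\<close>
  have "sdim \<sigma> = n \<longleftrightarrow> card \<sigma> = n + 1" if "\<sigma> \<in> K"
  proof -
    have "card \<sigma> > 0" using finite_nonempty[OF that] by (simp add: card_gt_0_iff)
    then show ?thesis unfolding sdim_def by arith
  qed
  then show ?thesis using finite_nonempty by (auto simp: chain_basis_def)
qed

text \<open>A divisor of a nonzero weight is nonzero, so the quotients in the boundary formula are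
  meaningful. Degree \<open>Suc n\<close> keeps the facets nonempty.\<close>

lemma facet_in_chain_basis:
  assumes "\<sigma> \<in> chain_basis K w (Suc n)" "v \<in> \<sigma>"
  shows "\<sigma> - {v} \<in> chain_basis K w n" "w (\<sigma> - {v}) dvd w \<sigma>"
proof -
  have \<sigma>: "\<sigma> \<in> K" "finite \<sigma>" "card \<sigma> = Suc (Suc n)" "w \<sigma> \<noteq> 0"
    using assms(1) by (auto simp: chain_basis_iff)
  then have "card (\<sigma> - {v}) = n + 1" using assms(2) by simp
  moreover from this have "\<sigma> - {v} \<noteq> {}" by force
  moreover from this show "w (\<sigma> - {v}) dvd w \<sigma>" using weight_dvd[of \<sigma> "\<sigma> - {v}"] \<sigma> by auto
  ultimately show "\<sigma> - {v} \<in> chain_basis K w n"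
    using face_in_K[of \<sigma> "\<sigma> - {v}"] \<sigma> by (auto simp: chain_basis_iff)
qed

lemma simplex_boundary_in_chains:
  assumes "\<sigma> \<in> chain_basis K w (Suc n)"
  shows "simplex_boundary w (Suc n) \<sigma> \<in> chains K w n"
proof -
  have "simplex_boundary w (Suc n) \<sigma> \<tau> = 0" if "\<tau> \<notin> chain_basis K w n" for \<tau>
    using assms that facet_in_chain_basis(1)[OF assms]
    by (intro simplex_boundary_eq_0) (auto simp: chain_basis_iff)
  then show ?thesis by (simp add: chains_def)
qed

text \<open>After telescoping, the weight factor depends only on \<sigma> and \<tau>, so the
  classical cancellation applies: the two orders of deleting two vertices carry opposite
  signs.\<close>

lemma boundary_simplex_boundary:
  assumes \<sigma>: "\<sigma> \<in> chain_basis K w (Suc n)"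
  shows "boundary K w n (simplex_boundary w (Suc n) \<sigma>) = 0"
proof (cases n)
  case 0
  then show ?thesis by (simp add: boundary_def)
next
  case (Suc m)
  then have n0: "n \<noteq> 0" by simp
  have fin: "finite \<sigma>" "card \<sigma> = Suc n + 1" using \<sigma> by (auto simp: chain_basis_iff)
  have facet: "\<sigma> - {v} \<in> chain_basis K w (Suc m)" if "v \<in> \<sigma>" for v
    using facet_in_chain_basis[OF \<sigma> that] Suc by simp
  have "boundary K w n (simplex_boundary w (Suc n) \<sigma>) \<tau> = 0" for \<tau>
  proof -
    \<comment> \<open>The contribution to the coefficient of \<tau> from deleting \<open>v\<close>
      first and \<open>u\<close> second.\<close>
    define g :: "'a \<Rightarrow> 'a \<Rightarrow> 'r" where
      "g v u = (if \<tau> = \<sigma> - {v} - {u} then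
        exact_quotient (w \<sigma>) (w \<tau>) * (face_sign \<sigma> v * face_sign (\<sigma> - {v}) u) else 0)" for v u
    have facet_term: "exact_quotient (w \<sigma>) (w (\<sigma> - {v})) * face_sign \<sigma> v * simplex_boundary w n (\<sigma> - {v}) \<tau>
        = (\<Sum>u\<in>\<sigma> - {v}. g v u)" if v: "v \<in> \<sigma>" for v
    proof -
      have card: "card (\<sigma> - {v}) = n + 1" using fin v by simp
      have chain: "exact_quotient (w \<sigma>) (w (\<sigma> - {v})) * exact_quotient (w (\<sigma> - {v})) (w \<tau>)
          = exact_quotient (w \<sigma>) (w \<tau>)" if u: "u \<in> \<sigma> - {v}" "\<tau> = \<sigma> - {v} - {u}" for u
        using facet_in_chain_basis[OF \<sigma> v] facet_in_chain_basis[OF facet[OF v] u(1)] u(2) facet[OF v]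
        by (intro exact_quotient_chain) (auto simp: chain_basis_def)
      show ?thesis
        unfolding simplex_boundary_apply[OF finite_Diff[OF fin(1)] card] sum_distrib_left
      proof (intro sum.cong refl)
        fix u assume u: "u \<in> \<sigma> - {v}"
        have "exact_quotient (w \<sigma>) (w (\<sigma> - {v})) * face_sign \<sigma> v *
              (exact_quotient (w (\<sigma> - {v})) (w \<tau>) * face_sign (\<sigma> - {v}) u)
            = (exact_quotient (w \<sigma>) (w (\<sigma> - {v})) * exact_quotient (w (\<sigma> - {v})) (w \<tau>)) *
              (face_sign \<sigma> v * face_sign (\<sigma> - {v}) u)"
          by (simp only: mult_ac)
        then show "exact_quotient (w \<sigma>) (w (\<sigma> - {v})) * face_sign \<sigma> v *
            (if \<tau> = \<sigma> - {v} - {u} then exact_quotient (w (\<sigma> - {v})) (w \<tau>) * face_sign (\<sigma> - {v}) u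
             else 0) = g v u"
          using chain[OF u] unfolding g_def
          by (cases "\<tau> = \<sigma> - {v} - {u}") (simp_all only: simp_thms if_True if_False mult_zero_right)
      qed
    qed
    have "boundary K w n (simplex_boundary w (Suc n) \<sigma>) \<tau> =
      (\<Sum>\<rho>\<in>chain_basis K w n. \<Sum>v\<in>\<sigma>. if \<rho> = \<sigma> - {v}
        then exact_quotient (w \<sigma>) (w \<rho>) * face_sign \<sigma> v * simplex_boundary w n \<rho> \<tau> else 0)"
      unfolding boundary_apply[OF n0]
        simplex_boundary_apply[OF fin] sum_distrib_right
      by (intro sum.cong refl) simp
    also have "\<dots> = (\<Sum>v\<in>\<sigma>. \<Sum>\<rho>\<in>chain_basis K w n. if \<rho> = \<sigma> - {v}
        then exact_quotient (w \<sigma>) (w \<rho>) * face_sign \<sigma> v * simplex_boundary w n \<rho> \<tau> else 0)"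
      by (rule sum.swap)
    also have "\<dots> = (\<Sum>v\<in>\<sigma>. \<Sum>u\<in>\<sigma> - {v}. g v u)"
    proof (intro sum.cong refl)
      fix v assume v: "v \<in> \<sigma>"
      have "finite (chain_basis K w n)" using finite_K by (simp add: chain_basis_def)
      then show "(\<Sum>\<rho>\<in>chain_basis K w n. if \<rho> = \<sigma> - {v}
          then exact_quotient (w \<sigma>) (w \<rho>) * face_sign \<sigma> v * simplex_boundary w n \<rho> \<tau> else 0)
        = (\<Sum>u\<in>\<sigma> - {v}. g v u)"
        using facet[OF v] Suc by (simp add: sum.delta facet_term[OF v, unfolded Suc])
    qed
    also have "\<dots> = 0"
    proof (rule sum_antisymmetric[OF fin(1)])
      fix u v assume "u \<in> \<sigma>" "v \<in> \<sigma>" "u < v"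
      moreover have "\<sigma> - {u} - {v} = \<sigma> - {v} - {u}" by blast
      ultimately show "g u v = - g v u"
        using face_sign_swap[OF fin(1), of u v, where 'r = 'r] by (simp add: g_def)
    qed
    finally show ?thesis .
  qed
  then show ?thesis by (simp add: fun_eq_iff)
qed

end

section \<open>Quotients and the homology of a collapse\<close>

lemma module_isomorphic_refl: "module_isomorphic M M"
  unfolding module_isomorphic_def by (rule exI[of _ id]) auto

lemma module_isomorphic_trans:
  assumes "module_isomorphic M N" "module_isomorphic N P" shows "module_isomorphic M P"
proof -
  obtain \<phi> where \<phi>: "bij_betw \<phi> (mcarrier M) (mcarrier N)"
    "\<And>x y. x \<in> mcarrier M \<Longrightarrow> y \<in> mcarrier M \<Longrightarrow> \<phi> (madd M x y) = madd N (\<phi> x) (\<phi> y)"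
    "\<And>r x. x \<in> mcarrier M \<Longrightarrow> \<phi> (mscale M r x) = mscale N r (\<phi> x)"
    using assms(1) unfolding module_isomorphic_def by blast
  obtain \<psi> where \<psi>: "bij_betw \<psi> (mcarrier N) (mcarrier P)"
    "\<And>x y. x \<in> mcarrier N \<Longrightarrow> y \<in> mcarrier N \<Longrightarrow> \<psi> (madd N x y) = madd P (\<psi> x) (\<psi> y)"
    "\<And>r x. x \<in> mcarrier N \<Longrightarrow> \<psi> (mscale N r x) = mscale P r (\<psi> x)"
    using assms(2) unfolding module_isomorphic_def by blast
  have "\<phi> x \<in> mcarrier N" if "x \<in> mcarrier M" for x
    using \<phi>(1) that by (rule bij_betw_apply)
  then show ?thesis unfolding module_isomorphic_def
    using bij_betw_trans[OF \<phi>(1) \<psi>(1)] \<phi>(2,3) \<psi>(2,3) by (intro exI[of _ "\<psi> \<circ> \<phi>"]) simp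
qed

text \<open>The structures are bare records, and the inverse map cancels \<phi> only on the carrier
  of \<open>M\<close>. Closure under the operations keeps the sums and multiples there.\<close>

lemma module_isomorphic_sym:
  assumes "module_isomorphic M N"
    and add: "\<And>x y. x \<in> mcarrier M \<Longrightarrow> y \<in> mcarrier M \<Longrightarrow> madd M x y \<in> mcarrier M"
    and scale: "\<And>r x. x \<in> mcarrier M \<Longrightarrow> mscale M r x \<in> mcarrier M"
  shows "module_isomorphic N M"
proof -
  obtain \<phi> where \<phi>: "bij_betw \<phi> (mcarrier M) (mcarrier N)"
    "\<And>x y. x \<in> mcarrier M \<Longrightarrow> y \<in> mcarrier M \<Longrightarrow> \<phi> (madd M x y) = madd N (\<phi> x) (\<phi> y)"
    "\<And>r x. x \<in> mcarrier M \<Longrightarrow> \<phi> (mscale M r x) = mscale N r (\<phi> x)"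
    using assms(1) unfolding module_isomorphic_def by blast
  define \<psi> where "\<psi> = the_inv_into (mcarrier M) \<phi>"
  have \<psi>: "bij_betw \<psi> (mcarrier N) (mcarrier M)"
    unfolding \<psi>_def using \<phi>(1) by (rule bij_betw_the_inv_into)
  have in_M: "\<psi> x \<in> mcarrier M" if "x \<in> mcarrier N" for x
    using \<psi> that by (rule bij_betw_apply)
  have \<phi>\<psi>: "\<phi> (\<psi> x) = x" if "x \<in> mcarrier N" for x
    unfolding \<psi>_def using f_the_inv_into_f_bij_betw[OF \<phi>(1)] that by blast
  have \<psi>\<phi>: "\<psi> (\<phi> x) = x" if "x \<in> mcarrier M" for x
    unfolding \<psi>_def using \<phi>(1) that by (simp add: bij_betw_def the_inv_into_f_f)
  have "\<psi> (madd N x y) = madd M (\<psi> x) (\<psi> y)" if "x \<in> mcarrier N" "y \<in> mcarrier N" for x y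
    using \<psi>\<phi>[OF add[OF in_M[OF that(1)] in_M[OF that(2)]]] \<phi>(2)[OF in_M[OF that(1)] in_M[OF that(2)]]
      \<phi>\<psi> that by simp
  moreover have "\<psi> (mscale N r x) = mscale M r (\<psi> x)" if "x \<in> mcarrier N" for r x
    using \<psi>\<phi>[OF scale[OF in_M[OF that]]] \<phi>(3)[OF in_M[OF that]] \<phi>\<psi> that by simp
  ultimately show ?thesis unfolding module_isomorphic_def using \<psi> by blast
qed

section \<open>Coset arithmetic and a criterion for isomorphic quotients\<close>

definition submodule :: "('a, 'r::idom) chain set \<Rightarrow> bool" where
  "submodule B \<longleftrightarrow>
     0 \<in> B \<and> (\<forall>x\<in>B. \<forall>y\<in>B. x + y \<in> B) \<and> (\<forall>r. \<forall>x\<in>B. chain_scale r x \<in> B)"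

lemma chain_scale_zero [simp]: "chain_scale r 0 = 0"
  by (rule ext) (simp add: chain_scale_def)

lemma chain_scale_add: "chain_scale r (x + y) = chain_scale r x + chain_scale r y"
  by (rule ext) (simp add: chain_scale_def distrib_left)

lemma submodule_diff:
  assumes "submodule B" "x \<in> B" "y \<in> B" shows "x - y \<in> B"
proof -
  have "x - y = x + chain_scale (-1) y" by (rule ext) (simp add: chain_scale_def)
  moreover have "x + chain_scale (-1) y \<in> B" using assms by (simp add: submodule_def)
  ultimately show ?thesis by (simp only:)
qed

text \<open>Removes the surplus summands that elementwise operations on cosets create, such as
  \<open>B + B\<close>.\<close>

lemma submodule_absorb:
  assumes "submodule B" "B' \<subseteq> B" "0 \<in> B'" shows "B' + B = B"
proof
  show "B' + B \<subseteq> B" using assms by (auto simp: set_plus_def submodule_def)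
  show "B \<subseteq> B' + B"
  proof
    fix x assume "x \<in> B"
    then have "0 + x \<in> B' + B" using assms(3) by (intro set_plus_intro)
    then show "x \<in> B' + B" by simp
  qed
qed

lemma submodule_scale_absorb:
  assumes "submodule B" shows "chain_scale r ` B + B = B"
proof (rule submodule_absorb[OF assms])
  show "chain_scale r ` B \<subseteq> B" using assms by (auto simp: submodule_def)
  have "chain_scale r 0 \<in> chain_scale r ` B"
    using assms unfolding submodule_def by (intro imageI) blast
  then show "0 \<in> chain_scale r ` B" by simp
qed

lemma coset_add: "(x +o A) + B = x +o (A + (B :: ('a, 'r::idom) chain set))"
  by (simp add: set_plus_rearrange3)

lemma coset_sum: "(x +o B) + (y +o B) = (x + y) +o (B + (B :: ('a, 'r::idom) chain set))"
  by (simp add: set_plus_rearrange)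

lemma scale_set_plus: "chain_scale r ` (X + Y) = chain_scale r ` X + chain_scale r ` Y"
  by (force simp: set_plus_def chain_scale_add image_iff)

lemma scale_coset: "chain_scale r ` (x +o B) = chain_scale r x +o chain_scale r ` B"
  by (force simp: elt_set_plus_def chain_scale_add image_iff)

lemma coset_eq_iff:
  assumes "submodule B" shows "x +o B = y +o B \<longleftrightarrow> x - y \<in> B"
proof
  assume eq: "x +o B = y +o B"
  have "x + 0 \<in> x +o B" using assms by (intro set_plus_intro2) (simp add: submodule_def)
  then have "x \<in> y +o B" using eq by simp
  then show "x - y \<in> B" by (auto simp: elt_set_plus_def)
next
  have sub: "x +o B \<subseteq> y +o B" if "x - y \<in> B" for x y
  proof
    fix z assume "z \<in> x +o B"
    then obtain b where b: "b \<in> B" "z = x + b" by (auto simp: elt_set_plus_def)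
    have "(x - y) + b \<in> B" using assms that b by (simp add: submodule_def)
    then have "y + ((x - y) + b) \<in> y +o B" by (rule set_plus_intro2)
    then show "z \<in> y +o B" using b by simp
  qed
  assume "x - y \<in> B"
  moreover have "0 \<in> B" using assms by (simp add: submodule_def)
  ultimately have "0 - (x - y) \<in> B" using submodule_diff[OF assms] by blast
  then have "y - x \<in> B" by simp
  then show "x +o B = y +o B" using sub \<open>x - y \<in> B\<close> by (intro equalityI)
qed

lemma quotient_module_closed:
  assumes Z: "submodule Z" and B: "submodule B"
    and X: "X \<in> mcarrier (quotient_module Z B)"
  shows "Y \<in> mcarrier (quotient_module Z B) \<Longrightarrow>
      madd (quotient_module Z B) X Y \<in> mcarrier (quotient_module Z B)"
    and "mscale (quotient_module Z B) r X \<in> mcarrier (quotient_module Z B)"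
proof -
  obtain x where x: "x \<in> Z" "X = x +o B" using X by (auto simp: quotient_module_def)
  have BB: "B + B = B" using submodule_absorb B by (auto simp: submodule_def)
  show "madd (quotient_module Z B) X Y \<in> mcarrier (quotient_module Z B)"
    if Y: "Y \<in> mcarrier (quotient_module Z B)"
  proof -
    obtain y where y: "y \<in> Z" "Y = y +o B" using Y by (auto simp: quotient_module_def)
    have "X + Y = (x + y) +o B" using x y coset_sum[of x B y] BB by simp
    then show ?thesis using x y Z by (auto simp: quotient_module_def submodule_def)
  qed
  have "chain_scale r ` X + B = chain_scale r x +o B"
    using x by (simp add: scale_coset coset_add submodule_scale_absorb[OF B])
  then show "mscale (quotient_module Z B) r X \<in> mcarrier (quotient_module Z B)"
    using x Z by (auto simp: quotient_module_def submodule_def)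
qed

text \<open>The isomorphism is induced by the inclusion of \<open>Z'\<close> in \<open>Z\<close>. As
  \<open>B' + B = B\<close>, the map that adds \<open>B\<close> to a coset sends
  \<open>z +o B'\<close> to \<open>z +o B\<close> without choosing representatives. Injectivity
  comes from \<open>Z' \<inter> B \<subseteq> B'\<close>.\<close>

lemma quotient_module_isomorphic:
  assumes Z': "submodule Z'" and B': "submodule B'" and B: "submodule B"
    and "B' \<subseteq> B" "Z' \<subseteq> Z" "Z' \<inter> B \<subseteq> B'"
    and surj: "\<And>z. z \<in> Z \<Longrightarrow> \<exists>z'\<in>Z'. z - z' \<in> B"
  shows "module_isomorphic (quotient_module Z' B') (quotient_module Z B)"
proof -
  have BB: "B + B = B" using submodule_absorb B by (auto simp: submodule_def)
  have B'B: "B' + B = B" using submodule_absorb B B' \<open>B' \<subseteq> B\<close> by (auto simp: submodule_def)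
  let ?\<phi> = "\<lambda>X. X + B"
  have \<phi>: "?\<phi> (z +o B') = z +o B" for z by (simp add: coset_add B'B)
  have "inj_on ?\<phi> ((\<lambda>z. z +o B') ` Z')"
  proof (rule inj_onI)
    fix X Y assume "X \<in> (\<lambda>z. z +o B') ` Z'" "Y \<in> (\<lambda>z. z +o B') ` Z'" and eq: "X + B = Y + B"
    then obtain x y where xy: "x \<in> Z'" "X = x +o B'" "y \<in> Z'" "Y = y +o B'" by blast
    then have "x - y \<in> B" using eq by (simp add: \<phi> coset_eq_iff[OF B])
    then have "x - y \<in> B'" using submodule_diff[OF Z' xy(1,3)] \<open>Z' \<inter> B \<subseteq> B'\<close> by blast
    then show "X = Y" using xy by (simp add: coset_eq_iff[OF B'])
  qed
  moreover have "?\<phi> ` (\<lambda>z. z +o B') ` Z' = (\<lambda>z. z +o B) ` Z"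
  proof
    show "?\<phi> ` (\<lambda>z. z +o B') ` Z' \<subseteq> (\<lambda>z. z +o B) ` Z" using \<phi> \<open>Z' \<subseteq> Z\<close> by auto
    show "(\<lambda>z. z +o B) ` Z \<subseteq> ?\<phi> ` (\<lambda>z. z +o B') ` Z'"
    proof
      fix X assume "X \<in> (\<lambda>z. z +o B) ` Z"
      then obtain z where z: "z \<in> Z" "X = z +o B" by blast
      then obtain z' where "z' \<in> Z'" "z - z' \<in> B" using surj by blast
      then have "X = ?\<phi> (z' +o B')" using z coset_eq_iff[OF B] by (simp add: \<phi>)
      then show "X \<in> ?\<phi> ` (\<lambda>z. z +o B') ` Z'" using \<open>z' \<in> Z'\<close> by blast
    qed
  qed
  ultimately have "bij_betw ?\<phi> ((\<lambda>z. z +o B') ` Z') ((\<lambda>z. z +o B) ` Z)"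
    by (simp add: bij_betw_def)
  moreover have "X + Y + B = (X + B) + (Y + B)" for X Y :: "('a, 'b) chain set"
  proof -
    have "(X + B) + (Y + B) = X + Y + (B + B)" by (simp only: add_ac)
    then show ?thesis by (simp only: BB)
  qed
  moreover have "(chain_scale r ` X + B') + B = chain_scale r ` (X + B) + B" for r X
    by (simp only: scale_set_plus add.assoc B'B submodule_scale_absorb[OF B])
  ultimately show ?thesis
    unfolding module_isomorphic_def quotient_module_def by (intro exI[of _ ?\<phi>]) simp
qed

lemma submodule_cycles: "submodule (cycles K w n)"
proof -
  have "boundary K w n 0 = 0" using boundary_diff[of K w n 0 0] by simp
  then show ?thesis
    by (simp add: submodule_def cycles_def chains_closed boundary_add boundary_scale)
qed

lemma submodule_boundaries: "submodule (boundaries K w n)"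
proof -
  have "boundary K w (n + 1) 0 = 0" using boundary_diff[of K w "n + 1" 0 0] by simp
  then have "0 \<in> boundaries K w n"
    unfolding boundaries_def using chains_closed(4) by (metis image_eqI)
  then show ?thesis
    unfolding submodule_def boundaries_def
    by (auto simp: boundary_add[symmetric] boundary_scale[symmetric] intro!: imageI chains_closed)
qed

section \<open>Homology across one elementary collapse\<close>

context weighted_complex
begin

text \<open>Correcting by a multiple of the boundary of \<open>\<beta>\<close>, in which \<open>\<gamma>\<close> has a unit coefficient because
  its weight equals that of \<open>\<beta>\<close>, removes \<open>\<gamma>\<close> from a chain. The coefficient of \<open>\<beta>\<close> in a chain is,
  up to sign, that of \<open>\<gamma>\<close> in its boundary.\<close>

lemma chain_avoiding_free_pair:
  assumes free: "free_face K \<gamma> \<beta>" and codim: "sdim \<beta> = sdim \<gamma> + 1"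
    and weight: "w \<gamma> = w \<beta>" "w \<beta> \<noteq> 0"
    and c: "c \<in> chains K w n" "boundary K w n c \<gamma> = 0"
  obtains c' where "c' \<in> chains (K - {\<gamma>,\<beta>}) w n" "boundary K w n c' = boundary K w n c"
    "c - c' \<in> boundaries K w n"
proof -
  let ?m = "sdim \<gamma>"
  have \<gamma>: "\<gamma> \<in> chain_basis K w ?m" and \<beta>: "\<beta> \<in> chain_basis K w (Suc ?m)"
    using free codim weight by (auto simp: free_face_def chain_basis_def)
  have fin\<beta>: "finite \<beta>" "card \<beta> = Suc ?m + 1" using \<beta> by (auto simp: chain_basis_iff)
  have "\<gamma> \<subset> \<beta>" using free by (simp add: free_face_def)
  then have "card (\<beta> - \<gamma>) = 1"
    using fin\<beta> \<gamma> by (subst card_Diff_subset) (auto simp: chain_basis_iff)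
  then obtain v where v: "\<beta> - \<gamma> = {v}" by (rule card_1_singletonE)
  then have facet: "v \<in> \<beta>" "\<gamma> = \<beta> - {v}" using \<open>\<gamma> \<subset> \<beta>\<close> by auto
  let ?D = "simplex_boundary w (Suc ?m) \<beta>"
  let ?s = "face_sign \<beta> v :: 'r"
  have D\<gamma>: "?D \<gamma> = ?s"
    using simplex_boundary_facet[OF fin\<beta> facet(1), of w] weight
    by (simp add: facet(2)[symmetric] exact_quotient_self)
  have chains_sub: "d \<in> chains (K - {\<gamma>,\<beta>}) w n" if "d \<in> chains K w n" "d \<gamma> = 0" "d \<beta> = 0" for d
    using that by (auto simp: chains_def chain_basis_def)
  have off: "d \<sigma> = 0" if "d \<in> chains K w n" "sdim \<sigma> \<noteq> n" for d \<sigma>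
    using that by (auto simp: chains_def chain_basis_def)
  have zero: "0 \<in> boundaries K w n"
    using submodule_boundaries[of K w n] by (simp add: submodule_def)
  consider "n = ?m" | "n = Suc ?m" | "n \<noteq> ?m" "n \<noteq> Suc ?m" by blast
  then show thesis
  proof cases
    case 1
    \<comment> \<open>The sign \<open>?s\<close> is its own inverse, so this multiple of the
      boundary of \<beta> has exactly the coefficient of \<open>c\<close> at \<gamma>. The corrected
      chain vanishes at \<beta> for reasons of dimension.\<close>
    define e where "e = chain_scale (c \<gamma> * ?s) (basis_chain \<beta>)"
    define c' where "c' = c - chain_scale (c \<gamma> * ?s) ?D"
    have "basis_chain \<beta> \<in> chains K w (Suc n)"
      using \<beta> 1 by (auto simp: chains_def basis_chain_def)
    then have e: "e \<in> chains K w (n + 1)" by (simp add: e_def chains_closed)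
    have boundary_e: "boundary K w (n + 1) e = c - c'"
      using boundary_basis_chain[OF finite_K \<beta>] 1 by (simp add: e_def c'_def boundary_scale)
    then have "c - c' \<in> boundaries K w n" using e unfolding boundaries_def by (metis image_eqI)
    moreover have c': "c' \<in> chains K w n"
      using c(1) simplex_boundary_in_chains[OF \<beta>] 1 by (simp add: c'_def chains_closed)
    moreover have "c' \<gamma> = c \<gamma> - c \<gamma> * (?s * ?s)"
      by (simp add: c'_def chain_scale_def D\<gamma> mult.assoc)
    then have "c' \<gamma> = 0" by (simp add: face_sign_sq)
    moreover have "c' \<beta> = 0" using off[OF c'] codim 1 by simp
    moreover have "boundary K w n c' = boundary K w n c"
      using boundary_simplex_boundary[OF \<beta>] 1
      by (simp add: c'_def boundary_diff boundary_scale)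
    ultimately show thesis using that chains_sub by blast
  next
    case 2
    have "boundary K w n c \<gamma> = (\<Sum>\<sigma>\<in>chain_basis K w n. c \<sigma> * simplex_boundary w n \<sigma> \<gamma>)"
      using 2 by (simp add: boundary_apply)
    \<comment> \<open>Freeness enters here: no other simplex of K has \<gamma> as a proper
      face.\<close>
    also have "\<dots> = (\<Sum>\<sigma>\<in>{\<beta>}. c \<sigma> * simplex_boundary w n \<sigma> \<gamma>)"
    proof (intro sum.mono_neutral_right ballI)
      show "finite (chain_basis K w n)" using finite_K by (simp add: chain_basis_def)
      show "{\<beta>} \<subseteq> chain_basis K w n" using \<beta> 2 by simp
      fix \<sigma> assume \<sigma>: "\<sigma> \<in> chain_basis K w n - {\<beta>}"
      then have "\<sigma> \<in> K" "\<sigma> \<noteq> \<beta>" by (auto simp: chain_basis_def)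
      then have "\<not> \<gamma> \<subset> \<sigma>" using free by (auto simp: free_face_def)
      then have "simplex_boundary w n \<sigma> \<gamma> = 0"
        using \<sigma> by (intro simplex_boundary_eq_0) (auto simp: chain_basis_iff)
      then show "c \<sigma> * simplex_boundary w n \<sigma> \<gamma> = 0" by simp
    qed
    also have "\<dots> = c \<beta> * ?s" using D\<gamma> 2 by simp
    finally have "c \<beta> * ?s * ?s = 0" using c(2) by simp
    then have "c \<beta> = 0" using face_sign_sq[of \<beta> v, where 'r = 'r] by (simp add: mult.assoc)
    moreover have "c \<gamma> = 0" using off[OF c(1)] 2 by simp
    ultimately show thesis using that[of c] chains_sub[OF c(1)] zero by simp
  next
    case 3
    then have "c \<gamma> = 0" "c \<beta> = 0" using off[OF c(1)] codim by auto
    then show thesis using that[of c] chains_sub[OF c(1)] zero by simp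
  qed
qed

text \<open>Avoiding the pair in degree i + 1 moves a bounding chain into the smaller complex and
  gives injectivity; avoiding it in degree i replaces a cycle by a homologous one there and gives
  surjectivity.\<close>

lemma homology_collapse:
  assumes pair: "free_face K \<gamma> \<beta>" "sdim \<beta> = sdim \<gamma> + 1" "w \<gamma> = w \<beta>" "w \<beta> \<noteq> 0"
  shows "module_isomorphic (homology K w i) (homology (K - {\<gamma>,\<beta>}) w i)"
proof -
  let ?L = "K - {\<gamma>,\<beta>}"
  have bd: "boundary ?L w n c = boundary K w n c" if "c \<in> chains ?L w n" for n c
    using boundary_subcomplex[OF _ finite_K that] by blast
  have sub: "chains ?L w n \<subseteq> chains K w n" for n by (rule chains_mono) blast
  have cycles: "cycles ?L w i = {c \<in> chains ?L w i. boundary K w i c = 0}"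
    using bd by (auto simp: cycles_def)
  have boundaries: "boundaries ?L w i = boundary K w (i + 1) ` chains ?L w (i + 1)"
    unfolding boundaries_def using bd by (rule image_cong[OF refl])
  have "module_isomorphic (quotient_module (cycles ?L w i) (boundaries ?L w i))
      (quotient_module (cycles K w i) (boundaries K w i))"
  proof (rule quotient_module_isomorphic)
    show "boundaries ?L w i \<subseteq> boundaries K w i"
      unfolding boundaries unfolding boundaries_def using sub by (rule image_mono)
    show "cycles ?L w i \<subseteq> cycles K w i" unfolding cycles using sub by (auto simp: cycles_def)
    show "cycles ?L w i \<inter> boundaries K w i \<subseteq> boundaries ?L w i"
    proof
      fix z assume z: "z \<in> cycles ?L w i \<inter> boundaries K w i"
      then obtain c where c: "c \<in> chains K w (i + 1)" "z = boundary K w (i + 1) c"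
        by (auto simp: boundaries_def)
      \<comment> \<open>As \<open>z\<close> is the boundary of \<open>c\<close>, this is the
        vanishing at \<gamma> required to move \<open>c\<close> off the pair.\<close>
      have "z \<gamma> = 0" using z by (auto simp: cycles_def chains_def chain_basis_def)
      then obtain c' where "c' \<in> chains ?L w (i + 1)" "boundary K w (i + 1) c' = z"
        using chain_avoiding_free_pair[OF pair c(1)] c(2) by metis
      then show "z \<in> boundaries ?L w i" unfolding boundaries by blast
    qed
    fix z assume "z \<in> cycles K w i"
    then have z: "z \<in> chains K w i" "boundary K w i z = 0" by (auto simp: cycles_def)
    then obtain z' where "z' \<in> chains ?L w i" "boundary K w i z' = 0" "z - z' \<in> boundaries K w i"
      using chain_avoiding_free_pair[OF pair z(1)] by (metis zero_fun_apply)
    then show "\<exists>z'\<in>cycles ?L w i. z - z' \<in> boundaries K w i" unfolding cycles by blast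
  qed (rule submodule_cycles submodule_boundaries)+
  \<comment> \<open>Inclusion maps the smaller complex into the larger one, so the isomorphism has
    to be inverted.\<close>
  then show ?thesis
    unfolding homology_def
    by (rule module_isomorphic_sym) (simp_all add: quotient_module_closed submodule_cycles submodule_boundaries)
qed

lemma weighted_simplicial_subcomplex:
  assumes "L \<subseteq> K"
    and L: "\<And>\<sigma> \<tau>. \<sigma> \<in> L \<Longrightarrow> \<tau> \<subseteq> \<sigma> \<Longrightarrow> \<tau> \<in> K \<Longrightarrow> \<tau> \<in> L"
  shows "weighted_simplicial_complex L w"
  unfolding weighted_simplicial_complex_def finite_simplicial_complex_def
proof (intro conjI ballI allI impI)
  show "finite L" using \<open>L \<subseteq> K\<close> finite_K by (rule finite_subset)
  fix \<sigma> assume "\<sigma> \<in> L"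
  then have \<sigma>: "\<sigma> \<in> K" using \<open>L \<subseteq> K\<close> by blast
  then show "finite \<sigma>" "\<sigma> \<noteq> {}" using finite_nonempty by blast+
  show "\<tau> \<in> L" if "\<tau> \<subseteq> \<sigma> \<and> \<tau> \<noteq> {}" for \<tau>
    using L[OF \<open>\<sigma> \<in> L\<close>] face_in_K[OF \<sigma>] that by blast
  show "w \<tau> dvd w \<sigma>" if "\<tau> \<in> L" "\<tau> \<subseteq> \<sigma>" for \<tau>
    using weight_dvd[OF \<sigma> that(2)] finite_nonempty[of \<tau>] that(1) \<open>L \<subseteq> K\<close> by blast
qed

end

text \<open>The hypotheses on \<open>L\<close> are chosen to survive the removal of a free pair, so
  that induction on the number of simplices outside \<open>N\<close> works. The pairing remains that
  of the fixed K, while the chain complex is that of the current \<open>L\<close>.\<close>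

lemma collapse_and_homology_of_paired:
  fixes K :: "'a::linorder set set" and w :: "'a set \<Rightarrow> 'r::idom"
  assumes morse: "discrete_morse K f" and wsc: "weighted_simplicial_complex K w"
    and "N \<subseteq> L" "L \<subseteq> K"
    and L: "\<And>\<sigma> \<tau>. \<sigma> \<in> L \<Longrightarrow> \<tau> \<subseteq> \<sigma> \<Longrightarrow> \<tau> \<in> K \<Longrightarrow> \<tau> \<in> L"
    and N: "\<And>\<sigma> \<tau>. \<sigma> \<in> N \<Longrightarrow> \<tau> \<subseteq> \<sigma> \<Longrightarrow> \<tau> \<in> K \<Longrightarrow> \<tau> \<in> N"
    and L_paired: "\<And>\<gamma> \<beta>. discrete_morse.paired K f \<gamma> \<beta> \<Longrightarrow> \<gamma> \<in> L \<longleftrightarrow> \<beta> \<in> L"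
    and N_paired: "\<And>\<gamma> \<beta>. discrete_morse.paired K f \<gamma> \<beta> \<Longrightarrow> \<gamma> \<in> N \<longleftrightarrow> \<beta> \<in> N"
    and all_paired: "\<And>\<sigma>. \<sigma> \<in> L - N \<Longrightarrow>
      \<exists>\<tau>. discrete_morse.paired K f \<sigma> \<tau> \<or> discrete_morse.paired K f \<tau> \<sigma>"
    and weight: "\<And>\<gamma> \<beta>. discrete_morse.paired K f \<gamma> \<beta> \<Longrightarrow> \<gamma> \<in> L - N \<Longrightarrow> w \<gamma> = w \<beta> \<and> w \<beta> \<noteq> 0"
  shows "collapses_onto L N \<and> (\<forall>i. module_isomorphic (homology L w i) (homology N w i))"
  using assms(3-)
proof (induction "card (L - N)" arbitrary: L rule: less_induct)
  case less
  interpret discrete_morse K f by (rule morse)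
  show ?case
  proof (cases "L - N = {}")
    case True
    then have "L = N" using less.prems(1) by blast
    then show ?thesis by (simp add: collapses_onto_def module_isomorphic_refl)
  next
    case False
    have "\<exists>\<gamma> \<beta>. paired \<gamma> \<beta> \<and> free_face L \<gamma> \<beta> \<and> \<gamma> \<in> L - N \<and> \<beta> \<in> L - N"
      by (rule exists_free_pair) (fact less.prems False)+
    then obtain \<gamma> \<beta> where \<gamma>\<beta>: "paired \<gamma> \<beta>" "free_face L \<gamma> \<beta>" "\<gamma> \<in> L - N" "\<beta> \<in> L - N"
      by blast
    let ?L = "L - {\<gamma>,\<beta>}"
    have "weighted_simplicial_complex L w"
      by (rule weighted_complex.weighted_simplicial_subcomplex[OF weighted_complex.intro[OF wsc]]) (fact less.prems)+
    then interpret weighted_complex L w by unfold_locales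
    have step: "module_isomorphic (homology L w i) (homology ?L w i)" for i
      using homology_collapse[OF \<gamma>\<beta>(2)] less.prems(8)[OF \<gamma>\<beta>(1,3)] \<gamma>\<beta>(1) by (simp add: paired_def)
    have "collapses_onto ?L N \<and> (\<forall>i. module_isomorphic (homology ?L w i) (homology N w i))"
    proof (rule less.hyps)
      have "finite (L - N)" using finite_K by simp
      then show "card (?L - N) < card (L - N)"
        using \<gamma>\<beta>(3) by (intro psubset_card_mono) auto
      show "N \<subseteq> ?L" using less.prems(1) \<gamma>\<beta> by blast
      show "?L \<subseteq> K" using less.prems(2) by blast
      show "\<tau> \<in> ?L" if "\<sigma> \<in> ?L" "\<tau> \<subseteq> \<sigma>" "\<tau> \<in> K" for \<sigma> \<tau>
      proof -
        have "\<tau> \<in> L" using less.prems(3)[of \<sigma> \<tau>] that by blast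
        \<comment> \<open>A simplex of \<open>L\<close> that contains \<gamma> or \<beta> contains
          \<gamma>, hence is one of the two. So no remaining simplex loses a face.\<close>
        moreover have "\<rho> = \<beta>" if "\<rho> \<in> L" "\<gamma> \<subset> \<rho>" for \<rho>
          using \<gamma>\<beta>(2) that by (simp add: free_face_def)
        then have "\<gamma> \<subseteq> \<rho> \<Longrightarrow> \<rho> \<in> L \<Longrightarrow> \<rho> \<in> {\<gamma>,\<beta>}" for \<rho> by blast
        moreover have "\<gamma> \<subset> \<beta>" using \<gamma>\<beta>(1) by (simp add: paired_def)
        ultimately show ?thesis using that by blast
      qed
      show "\<gamma>' \<in> ?L \<longleftrightarrow> \<beta>' \<in> ?L" if "paired \<gamma>' \<beta>'" for \<gamma>' \<beta>'
        using less.prems(5)[OF that] paired_in_pair_iff[OF \<gamma>\<beta>(1) that] by blast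
      show "\<exists>\<tau>. paired \<sigma> \<tau> \<or> paired \<tau> \<sigma>" if "\<sigma> \<in> ?L - N" for \<sigma>
        using less.prems(7)[of \<sigma>] that by blast
      show "w \<gamma>' = w \<beta>' \<and> w \<beta>' \<noteq> 0" if "paired \<gamma>' \<beta>'" "\<gamma>' \<in> ?L - N" for \<gamma>' \<beta>'
        using less.prems(8)[OF that(1)] that(2) by blast
    qed (fact less.prems)+
    moreover have "elementary_collapse L ?L" using \<gamma>\<beta>(2) by (auto simp: elementary_collapse_def)
    ultimately show ?thesis
      using converse_rtranclp_into_rtranclp[of elementary_collapse L ?L N]
        module_isomorphic_trans[OF step] unfolding collapses_onto_def by blast
  qed
qed

lemma collapse_and_homology_of_levels:
  fixes K :: "'a::linorder set set" and w :: "'a set \<Rightarrow> 'r::idom"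
  assumes "discrete_morse K f" "weighted_simplicial_complex K w" "c \<le> d"
    and not_critical: "\<forall>\<sigma>\<in>preimage K f {c<..d}. \<not> critical K f \<sigma>"
    and simple: "\<forall>\<sigma>\<in>preimage K f {c<..d}. w_simple K w f \<sigma>"
  shows "collapses_onto (level_subcomplex K f d) (level_subcomplex K f c) \<and>
    (\<forall>i. module_isomorphic (homology (level_subcomplex K f d) w i) (homology (level_subcomplex K f c) w i))"
proof -
  interpret discrete_morse K f by (rule assms(1))
  show ?thesis
  proof (rule collapse_and_homology_of_paired[OF assms(1,2)])
    show "level c \<subseteq> level d" using level_mono assms(3) .
    show "level d \<subseteq> K" by (rule level_subset)
    show "\<exists>\<tau>. paired \<sigma> \<tau> \<or> paired \<tau> \<sigma>" if "\<sigma> \<in> level d - level c" for \<sigma>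
      using level_diff_paired[OF not_critical that] by blast
    show "w \<gamma> = w \<beta> \<and> w \<beta> \<noteq> 0" if "paired \<gamma> \<beta>" "\<gamma> \<in> level d - level c" for \<gamma> \<beta>
      using level_diff_w_simple[OF simple that] by blast
  qed (use level_face level_paired in blast)+
qed

section \<open>Passing a critical simplex\<close>

theorem theorem4p12:
  fixes K :: "'a::linorder set set"
    and w :: "'a set \<Rightarrow> 'r::idom"
    and f :: "'a set \<Rightarrow> real"
    and a b a' :: real
    and \<alpha> :: "'a set"
    and n :: nat
  assumes wsc: "weighted_simplicial_complex K w"
    and morse: "discrete_morse_function K f"
    and less: "a < b"
    and crit: "critical K f \<alpha>" and dim: "sdim \<alpha> = n" and range: "f \<alpha> \<in> {a<..b}"
    and only: "\<forall>\<sigma>\<in>preimage K f {a<..b}. critical K f \<sigma> \<longrightarrow> \<sigma> = \<alpha>"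
    and a'_exists: "{x \<in> {a..<f \<alpha>}. preimage K f {x<..f \<alpha>} = {\<alpha>}} \<noteq> {}"
    and a'_eq: "a' = (LEAST x. x \<in> {x \<in> {a..<f \<alpha>}. preimage K f {x<..f \<alpha>} = {\<alpha>}})"
  shows "level_subcomplex K f a' = level_subcomplex K f (f \<alpha>) - {\<alpha>}
       \<and> \<alpha> \<in> level_subcomplex K f (f \<alpha>)
       \<and> \<not> (\<exists>\<tau>\<in>level_subcomplex K f (f \<alpha>). \<alpha> \<subset> \<tau>)
       \<and> ((\<forall>\<sigma>\<in>preimage K f {a<..a'} \<union> preimage K f {f \<alpha><..b}. w_simple K w f \<sigma>) \<longrightarrow>
            collapses_onto (level_subcomplex K f b) (level_subcomplex K f (f \<alpha>))
          \<and> collapses_onto (level_subcomplex K f a') (level_subcomplex K f a)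
          \<and> (\<forall>i. module_isomorphic (homology (level_subcomplex K f b) w i)
                                    (homology (level_subcomplex K f (f \<alpha>)) w i))
          \<and> (\<forall>i. module_isomorphic (homology (level_subcomplex K f a') w i)
                                    (homology (level_subcomplex K f a) w i)))"
proof -
  interpret discrete_morse K f
    using wsc morse by unfold_locales (simp_all add: weighted_simplicial_complex_def)
  have \<alpha>: "\<alpha> \<in> K" using crit by (simp add: critical_iff)
  let ?S = "{x \<in> {a..<f \<alpha>}. preimage K f {x<..f \<alpha>} = {\<alpha>}}"
  \<comment> \<open>A set of reals need not attain its infimum, so the minimum is exhibited: the
    largest value of f below f \<alpha>, or a if that is larger or there is none.\<close>
  let ?F = "insert a (f ` {\<sigma>\<in>K. f \<sigma> < f \<alpha>})"
  obtain x\<^sub>0 where x\<^sub>0: "x\<^sub>0 \<in> ?S" using a'_exists by blast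
  have "finite ?F" using finite_complex by simp
  then have max: "Max ?F \<in> ?F" "\<And>x. x \<in> ?F \<Longrightarrow> x \<le> Max ?F"
    by (rule Max_in, blast) (rule Max_ge[OF \<open>finite ?F\<close>])
  have "\<forall>x\<in>?F. x < f \<alpha>" using range by auto
  then have below: "Max ?F < f \<alpha>" using max(1) by blast
  have "preimage K f {Max ?F<..f \<alpha>} = {\<alpha>}"
  proof (intro equalityI subsetI)
    fix \<sigma> assume "\<sigma> \<in> preimage K f {Max ?F<..f \<alpha>}"
    then have \<sigma>: "\<sigma> \<in> K" "Max ?F < f \<sigma>" "f \<sigma> \<le> f \<alpha>" by (simp_all add: preimage_def)
    have "\<not> f \<sigma> < f \<alpha>" using max(2)[of "f \<sigma>"] \<sigma>(1,2) by auto
    \<comment> \<open>The choice of \<open>?F\<close> leaves only the value f \<alpha> itself; that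
      no other simplex has this value follows from the nonemptiness of \<open>?S\<close>.\<close>
    then have "\<sigma> \<in> preimage K f {x\<^sub>0<..f \<alpha>}" using \<sigma>(1,3) x\<^sub>0 by (auto simp: preimage_def)
    then show "\<sigma> \<in> {\<alpha>}" using x\<^sub>0 by blast
  qed (use \<alpha> below in \<open>auto simp: preimage_def\<close>)
  then have "Max ?F \<in> ?S" using below max(2)[of a] by simp
  \<comment> \<open>For a smaller x \<ge> a, the simplex attaining the maximum would be a second
    element of the preimage.\<close>
  moreover have "Max ?F \<le> x" if x: "x \<in> ?S" for x
  proof (rule ccontr)
    assume "\<not> Max ?F \<le> x"
    moreover have "a \<le> x" using x by simp
    ultimately have "Max ?F \<noteq> a" by auto
    then obtain \<sigma> where \<sigma>: "\<sigma> \<in> K" "f \<sigma> < f \<alpha>" "Max ?F = f \<sigma>" using max(1) by blast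
    then have "\<sigma> \<in> preimage K f {x<..f \<alpha>}"
      using \<open>\<not> Max ?F \<le> x\<close> unfolding \<sigma>(3) by (simp add: preimage_def)
    then show False using x \<sigma>(2) by auto
  qed
  ultimately have "a' \<in> ?S" unfolding a'_eq by (rule LeastI2_order) blast
  then have a': "a \<le> a'" "a' < f \<alpha>" "preimage K f {a'<..f \<alpha>} = {\<alpha>}" by auto
  have maximal: "\<not> \<alpha> \<subset> \<tau>" if "\<tau> \<in> level (f \<alpha>)" for \<tau>
  proof
    assume "\<alpha> \<subset> \<tau>"
    obtain \<delta> where "\<delta> \<in> K" "f \<delta> \<le> f \<alpha>" "\<tau> \<subseteq> \<delta>" using \<open>\<tau> \<in> level (f \<alpha>)\<close> by (rule levelE)
    then show False using critical_coface_gt[OF crit, of \<delta>] \<open>\<alpha> \<subset> \<tau>\<close> by auto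
  qed
  have low: "\<forall>\<sigma>\<in>preimage K f {a<..a'}. \<not> critical K f \<sigma>"
    using only a'(2) range by (fastforce simp: preimage_def)
  have high: "\<forall>\<sigma>\<in>preimage K f {f \<alpha><..b}. \<not> critical K f \<sigma>"
    using only range by (fastforce simp: preimage_def)
  show ?thesis
    using level_critical[OF crit a'(2,3)] level_of_le[OF \<alpha>, of "f \<alpha>"] maximal range
      collapse_and_homology_of_levels[OF discrete_morse_axioms wsc a'(1) low]
      collapse_and_homology_of_levels[OF discrete_morse_axioms wsc _ high]
    by (simp add: ball_Un)
qed

end
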